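(* Let $n\ge 2$. Every zero charge superization with translational supersymmetry $\mathfrak g=\mathfrak g_{\bar0}+\mathfrak g_{\bar1}=\mathfrak g_b+S$ of an $(n+1)$-dimensional CW algebra $\mathfrak g_b=\mathfrak h+\mathfrak m=E^*+(E+\mathbb R\mathrm p+\mathbb R\mathrm q)$ is uniquely determined by a solution $(c_1,c_2)\in(\mathrm{Cl}_{0,n-1})^2$ of the quadratic Clifford equation $$\text{i)}\ (L_{c_1}-R_{c_2})^2E\subseteq E,\qquad\text{ii)}\ (L_{c_1}-R_{c_2})^2|_E=-B,$$ by an element $c_3\in\mathrm{Cl}_{0,n-1}$ and by two bilinear forms $$\mathrm p_{-+}\in\mathrm{Bil}_{\mathbb R}(S_{0,n-1})^{\tau\sigma=-1},\qquad\mathrm p_{++}\in S_{0,n-1}^*\vee S_{0,n-1}^*$$ which satisfy the compatibility conditions (for all $s,t\in S_{0,n-1}$) $$\mathrm p_{-+}(c_3s,t)+\mathrm p_{-+}(c_3t,s)+\mathrm p_{++}(c_2s,t)+\mathrm p_{++}(s,c_2t)=0,$$ $$\mathrm p_{-+}(c_1s,t)+\mathrm p_{-+}(s,c_2t)=0.$$ Here $(c_1,c_2,c_3)$ is defined up to elements of the kernel of the spin representation $\rho_{0,n-1}:\mathrm{Cl}_{0,n-1}\to\mathrm{End}_{\mathbb R}(S_{0,n-1})$, if it is non-trivial. The associated zero charge superization is given by $$\mathrm{ad}_{\mathrm p}|_S=\begin{pmatrix}0&0\\0&0\end{pmatrix},\qquad\mathrm{ad}_{\mathrm q}|_S=\begin{pmatrix}c_1&c_3\\0&c_2\end{pmatrix},$$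 $$\mathrm{ad}_{e^\flat}|_S=\sqrt2\begin{pmatrix}0&Be\\0&0\end{pmatrix},\qquad\mathrm{ad}_e|_S=\sqrt2\begin{pmatrix}0&e\cdot\circ\,c_2-c_1\circ e\cdot\\0&0\end{pmatrix},$$ $$[Q,Q]=\big(\mathrm p_{++}(Q_+,Q_+)+2\,\mathrm p_{-+}(Q_-,Q_+)\big)\mathrm p,$$ where $e\in E$ and $Q=\begin{pmatrix}Q_-\\Q_+\end{pmatrix}\in S=S_-+S_+=S_{0,n-1}+S_{0,n-1}$.
   Context: $E=\mathbb R^{0,n-1}$ is an $(n-1)$-dimensional real vector space with a negative definite inner product $\langle\cdot,\cdot\rangle$; $e^\flat=\langle e,\cdot\rangle\in E^*$. $b$ is a non-degenerate symmetric bilinear form on $E$ and $B\in\mathrm{End}_{\mathbb R}(E)$ is defined by $b(\cdot,\cdot)=-\langle B\cdot,\cdot\rangle$. $\mathfrak m=E+\mathbb R\mathrm p+\mathbb R\mathrm q$ is $(n+1)$-dimensional Minkowski space ($\mathrm p,\mathrm q$ isotropic, orthogonal to $E$, $\langle\mathrm p,\mathrm q\rangle=1$). The Cahen-Wallach (CW) algebra associated with $b$ is the Lie algebra $\mathfrak g_b=\mathfrak h+\mathfrak m=E^*+(E+\mathbb R\mathrm p+\mathbb R\mathrm q)$ whose only non-trivial brackets are $[\mathrm q,e]=e^\flat$, $[e^\flat,f]=b(e,f)\mathrm p$, $[e^\flat,\mathrm q]=B(e)$ ($e,f\in E$); following the paper it is called $(n+1)$-dimensional, referring to $\dim\mathfrak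 m$. $\mathrm{Cl}_{0,n-1}$ is the Clifford algebra of $E\subset\mathrm{Cl}_{0,n-1}$ with convention $v^2=-\langle v,v\rangle$; $L_c$, $R_c\in\mathrm{End}_{\mathbb R}(\mathrm{Cl}_{0,n-1})$ are left and right multiplication by $c$. $\rho_{0,n-1}:\mathrm{Cl}_{0,n-1}\to\mathrm{End}_{\mathbb R}(S_{0,n-1})$ is a real irreducible representation; when acting on spinors, an element $c\in\mathrm{Cl}_{0,n-1}$ or a vector $e\in E$ stands for its action on $S_{0,n-1}$. $\mathfrak{so}(E)\hookrightarrow\mathrm{Cl}_{0,n-1}$ via $v\wedge w\mapsto\frac14[v,w]$. An $\mathfrak{so}(E)$-invariant bilinear form $\Gamma$ on $S_{0,n-1}$ is admissible if: (1) Clifford multiplication by vectors is $\Gamma$-symmetric (type $\tau=+1$) or $\Gamma$-skew-symmetric ($\tau=-1$); (2) $\Gamma$ is symmetric ($\sigma=+1$) or skew-symmetric ($\sigma=-1$); (3) if $S_{0,n-1}=S^+_{0,n-1}+S^-_{0,n-1}$ is reducible as $\mathfrak{so}(E)$-module, the irreducible summands (semi-spinors) are either mutually orthogonal or isotropic for $\Gamma$. $\mathrm{Bil}_{\mathbb R}(S_{0,n-1})^{\tau\sigma=-1}$ is the space spanned by admissible bilinear forms with $\tau\sigma=-1$. $S^*_{0,n-1}\vee S^*_{0,n-1}$ is the space of symmetric bilinear forms. $\rho_{\mathrm{spin}}:\mathrm{Cl}(\mathfrak m)\to\mathrm{End}_{\mathbb R}(S)$, $S=S_{1,n}$, is the real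 irreducible $\mathrm{Cl}(\mathfrak m)$-module. Explicitly, via $\mathrm{Cl}(\mathfrak m)\cong\mathrm{Cl}_{1,1}\hat\otimes\mathrm{Cl}_{0,n-1}$ ($\mathrm{Cl}_{1,1}$ generated by $\mathrm p,\mathrm q$), $S=S_-+S_+=S_{0,n-1}+S_{0,n-1}$ as a vector space and, with $\alpha$ the parity automorphism of $\mathrm{Cl}_{0,n-1}$, $$1\otimes c\mapsto\begin{pmatrix}\alpha(c)&0\\0&c\end{pmatrix},\ \mathrm p\otimes c\mapsto\begin{pmatrix}0&2\sqrt2c\\0&0\end{pmatrix},\ \mathrm q\otimes c\mapsto\begin{pmatrix}0&0\\-\frac1{\sqrt2}\alpha(c)&0\end{pmatrix},\ \mathrm p\mathrm q\otimes c\mapsto\begin{pmatrix}-2\alpha(c)&0\\0&0\end{pmatrix}.$$ A representation $\rho:\mathfrak g_b\to\mathfrak{gl}_{\mathbb R}(S)$ is spin if $\rho(e^\flat)$ is the spin action of $\mathrm p\wedge Be\in\mathfrak{so}(\mathfrak m)$, i.e. $\rho(e^\flat)=\begin{pmatrix}0&\sqrt2\,Be\\0&0\end{pmatrix}$ for all $e\in E$. It has zero charge if $\rho(\mathrm p)=0$. By convention, for zero charge spin representations of the CW algebra the condition $\rho(\mathfrak m)\subseteq\rho_{\mathrm{spin}}(\mathrm{Cl}(\mathfrak m))$ is always assumed. A superization of $\mathfrak g_b$ is a Lie superalgebra $\mathfrak g=\mathfrak g_{\bar0}+\mathfrak g_{\bar1}$ with $\mathfrak g_{\bar0}=\mathfrak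 g_b$, $\mathfrak g_{\bar1}=S$, such that the adjoint action of $\mathfrak g_{\bar0}$ on $\mathfrak g_{\bar1}$ is a spin representation; it has zero charge if this representation has, and it has translational supersymmetry if $[S,S]\subseteq\mathfrak m$. *)

theory Defs
  imports "HOL-Analysis.Analysis"
begin

text \<open>
  The space \<open>E = R^{0,n-1}\<close> is a type \<open>'e\<close> of class \<^class>\<open>euclidean_space\<close> with
  \<open>DIM('e) = n - 1\<close>, carrying the negative of the positive definite product of the class.
\<close>

definition ip :: "'e::euclidean_space \<Rightarrow> 'e \<Rightarrow> real" (\<open>\<langle>_,_\<rangle>\<close>)
  where "\<langle>x,y\<rangle> = - (x \<bullet> y)"

lemma ip_eqI:
  assumes "\<And>f. \<langle>x,f\<rangle> = \<langle>y,f\<rangle>"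
  shows "x = y"
  using assms vector_eq_rdot[of x y] by (metis ip_def neg_equal_iff_equal)


section \<open>The Clifford algebra of \<open>E\<close>\<close>

text \<open>
  The unital associative real algebra with generators \<open>Vec v\<close> and the relations \<open>v\<^sup>2 = -\<langle>v,v\<rangle>\<close>,
  linearly in \<open>v\<close>: terms modulo the least congruence that contains the algebra laws and these
  relations.  This is the quotient of the tensor algebra of \<open>E\<close> by the Clifford ideal; its
  universal property is \<open>cl_lift\<close> and \<open>cl_hom_unique\<close> below.
\<close>

datatype 'e cl_term =
    Scal real
  | Vec 'e
  | Plus "'e cl_term" "'e cl_term"
  | Times "'e cl_term" "'e cl_term"

inductive cl_eq :: "'e::euclidean_space cl_term \<Rightarrow> 'e cl_term \<Rightarrow> bool" where
  cl_refl: "cl_eq x x"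
| cl_sym: "cl_eq x y \<Longrightarrow> cl_eq y x"
| cl_trans: "cl_eq x y \<Longrightarrow> cl_eq y z \<Longrightarrow> cl_eq x z"
| cl_plus_cong: "cl_eq x x' \<Longrightarrow> cl_eq y y' \<Longrightarrow> cl_eq (Plus x y) (Plus x' y')"
| cl_times_cong: "cl_eq x x' \<Longrightarrow> cl_eq y y' \<Longrightarrow> cl_eq (Times x y) (Times x' y')"
| cl_plus_assoc: "cl_eq (Plus (Plus x y) z) (Plus x (Plus y z))"
| cl_plus_commute: "cl_eq (Plus x y) (Plus y x)"
| cl_plus_zero: "cl_eq (Plus (Scal 0) x) x"
| cl_plus_minus: "cl_eq (Plus (Times (Scal (-1)) x) x) (Scal 0)"
| cl_times_assoc: "cl_eq (Times (Times x y) z) (Times x (Times y z))"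
| cl_times_one_left: "cl_eq (Times (Scal 1) x) x"
| cl_times_one_right: "cl_eq (Times x (Scal 1)) x"
| cl_distrib_left: "cl_eq (Times x (Plus y z)) (Plus (Times x y) (Times x z))"
| cl_distrib_right: "cl_eq (Times (Plus x y) z) (Plus (Times x z) (Times y z))"
| cl_scal_plus: "cl_eq (Scal (a + b)) (Plus (Scal a) (Scal b))"
| cl_scal_times: "cl_eq (Scal (a * b)) (Times (Scal a) (Scal b))"
| cl_scal_central: "cl_eq (Times x (Scal a)) (Times (Scal a) x)"
| cl_vec_plus: "cl_eq (Vec (v + w)) (Plus (Vec v) (Vec w))"
| cl_vec_scal: "cl_eq (Vec (a *\<^sub>R v)) (Times (Scal a) (Vec v))"
| cl_clifford: "cl_eq (Times (Vec v) (Vec v)) (Scal (- \<langle>v,v\<rangle>))"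

quotient_type (overloaded) 'e clifford = "'e::euclidean_space cl_term" / cl_eq
  by (auto intro!: equivpI reflpI sympI transpI intro: cl_refl cl_sym cl_trans)

lift_definition cl_vec :: "'e::euclidean_space \<Rightarrow> 'e clifford" is Vec .

text \<open>
  That \<open>0 \<noteq> 1\<close> in this algebra is seen by letting the generators act on functions of finite sets
  of basis vectors (the creation and annihilation operators of an orthonormal basis).
\<close>

primrec term_op :: "('e \<Rightarrow> ('k \<Rightarrow> real) \<Rightarrow> 'k \<Rightarrow> real) \<Rightarrow> 'e cl_term \<Rightarrow> ('k \<Rightarrow> real) \<Rightarrow> 'k \<Rightarrow> real" where
  "term_op g (Scal a) = (\<lambda>f k. a * f k)"
| "term_op g (Vec v) = g v"
| "term_op g (Plus x y) = (\<lambda>f k. term_op g x f k + term_op g y f k)"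
| "term_op g (Times x y) = (\<lambda>f. term_op g x (term_op g y f))"

lemma term_op_linear:
  assumes add: "\<And>v f h. g v (\<lambda>k. f k + h k) = (\<lambda>k. g v f k + g v h k)"
    and scal: "\<And>v a f. g v (\<lambda>k. a * f k) = (\<lambda>k. a * g v f k)"
  shows "term_op g x (\<lambda>k. f k + h k) = (\<lambda>k. term_op g x f k + term_op g x h k)"
    and "term_op g x (\<lambda>k. a * f k) = (\<lambda>k. a * term_op g x f k)"
  by (induction x arbitrary: f h) (simp_all add: add scal algebra_simps)

lemma term_op_cl_eq:
  fixes g :: "'e::euclidean_space \<Rightarrow> ('k \<Rightarrow> real) \<Rightarrow> 'k \<Rightarrow> real"
  assumes add: "\<And>v f h. g v (\<lambda>k. f k + h k) = (\<lambda>k. g v f k + g v h k)"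
    and scal: "\<And>v a f. g v (\<lambda>k. a * f k) = (\<lambda>k. a * g v f k)"
    and addv: "\<And>v w f. g (v + w) f = (\<lambda>k. g v f k + g w f k)"
    and scalv: "\<And>a v f. g (a *\<^sub>R v) f = (\<lambda>k. a * g v f k)"
    and sq: "\<And>v f. g v (g v f) = (\<lambda>k. (v \<bullet> v) * f k)"
    and eq: "cl_eq x y"
  shows "term_op g x = term_op g y"
proof -
  have g: "g (v + w) = (\<lambda>f k. g v f k + g w f k)" "g (a *\<^sub>R v) = (\<lambda>f k. a * g v f k)" for v w a
    by (rule ext, rule addv, rule ext, rule scalv)
  show ?thesis
    using eq
    by induction (simp_all add: g sq ip_def term_op_linear[OF add scal] algebra_simps)
qed

lemma clifford_nontrivial: "\<not> cl_eq (Scal 0 :: 'e::euclidean_space cl_term) (Scal 1)"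
proof
  assume contr: "cl_eq (Scal 0 :: 'e cl_term) (Scal 1)"
  obtain r :: "'e \<Rightarrow> nat" where r: "inj_on r Basis"
    using finite_imp_inj_to_nat_seg[OF finite_Basis] by metis
  define u where "u a A = (if a \<in> A then -1 else 1 :: real)" for a :: 'e and A
  define s where "s b A = (\<Prod>a\<in>{a\<in>Basis. r a < r b}. u a A)" for b A
  define fl where "fl b A = (if b \<in> A then A - {b} else insert b A)" for b :: 'e and A
  define g where "g v f A = (\<Sum>b\<in>Basis. (v \<bullet> b) * (s b A * f (fl b A)))"
    for v :: 'e and f :: "'e set \<Rightarrow> real" and A
  have u_fl: "u a (fl c A) = (if a = c then - u a A else u a A)" for a c A
    unfolding u_def fl_def by (cases "a = c"; cases "a \<in> A"; cases "c \<in> A") simp_all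
  have s_fl: "s b (fl c A) = (if r c < r b then - s b A else s b A)"
    if "c \<in> Basis" for b c A
  proof (cases "r c < r b")
    case True
    then have c: "c \<in> {a\<in>Basis. r a < r b}" using that by simp
    have "(\<Prod>a\<in>{a\<in>Basis. r a < r b} - {c}. u a (fl c A)) = (\<Prod>a\<in>{a\<in>Basis. r a < r b} - {c}. u a A)"
      by (rule prod.cong) (auto simp: u_fl)
    moreover have "s b X = u c X * (\<Prod>a\<in>{a\<in>Basis. r a < r b} - {c}. u a X)" for X
      unfolding s_def by (rule prod.remove[OF _ c]) simp
    ultimately show ?thesis using True by (simp add: u_fl)
  next
    case False
    then have "s b (fl c A) = s b A"
      unfolding s_def by (intro prod.cong) (auto simp: u_fl)
    with False show ?thesis by simp
  qed
  have s_sq: "s b A * s b A = 1" for b A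
    unfolding s_def prod.distrib[symmetric] by (intro prod.neutral ballI) (simp add: u_def)
  have fl_iff: "x \<in> fl b A \<longleftrightarrow> (x \<in> A) \<noteq> (x = b)" for x b A
    unfolding fl_def by (cases "b \<in> A") auto
  have fl_fl: "fl b (fl b A) = A" for b A
    by (rule set_eqI) (unfold fl_iff, blast)
  have fl_comm: "fl b (fl c A) = fl c (fl b A)" for b c A
    by (rule set_eqI) (unfold fl_iff, blast)
  have sq: "g v (g v f) = (\<lambda>k. (v \<bullet> v) * f k)" for v f
  proof
    fix A
    define T where "T b c = (v \<bullet> b) * (v \<bullet> c) * (s b A * s c (fl b A) * f (fl c (fl b A)))" for b c
    have TT: "T b c + T c b = (if b = c then 2 * ((v \<bullet> b) * (v \<bullet> b) * f A) else 0)"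
      if "b \<in> Basis" "c \<in> Basis" for b c
    proof (cases "b = c")
      case True
      then show ?thesis using that by (simp add: T_def s_fl s_sq fl_fl)
    next
      case False
      then have "r b \<noteq> r c" using r that by (auto dest: inj_onD)
      then show ?thesis using False that
        by (auto simp: T_def s_fl fl_comm[of b c])
    qed
    have "g v (g v f) A = (\<Sum>b\<in>Basis. \<Sum>c\<in>Basis. T b c)"
      unfolding g_def T_def by (simp add: sum_distrib_left mult_ac)
    moreover have "\<dots> = (\<Sum>b\<in>Basis. \<Sum>c\<in>Basis. T c b)"
      by (rule sum.swap)
    ultimately have "2 * g v (g v f) A = (\<Sum>b\<in>Basis. \<Sum>c\<in>Basis. T b c + T c b)"
      by (simp add: sum.distrib)
    also have "\<dots> = (\<Sum>b\<in>Basis. 2 * ((v \<bullet> b) * (v \<bullet> b) * f A))"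
    proof (rule sum.cong[OF refl])
      fix b :: 'e
      assume b: "b \<in> Basis"
      then have "(\<Sum>c\<in>Basis. T b c + T c b)
          = (\<Sum>c\<in>Basis. if b = c then 2 * ((v \<bullet> b) * (v \<bullet> b) * f A) else 0)"
        by (intro sum.cong refl TT)
      with b show "(\<Sum>c\<in>Basis. T b c + T c b) = 2 * ((v \<bullet> b) * (v \<bullet> b) * f A)"
        by simp
    qed
    also have "\<dots> = 2 * ((v \<bullet> v) * f A)"
      by (subst (3) euclidean_inner) (simp add: sum_distrib_left sum_distrib_right)
    finally show "g v (g v f) A = (v \<bullet> v) * f A" by simp
  qed
  have "term_op g (Scal 0) = term_op g (Scal 1)"
    by (rule term_op_cl_eq[OF _ _ _ _ sq contr])
      (simp_all add: g_def fun_eq_iff algebra_simps sum.distrib sum_distrib_left)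
  from fun_cong[OF fun_cong[OF this, of "\<lambda>_. 1"]] show False
    by simp
qed

instantiation clifford :: (euclidean_space) real_algebra_1
begin

lift_definition zero_clifford :: "'a clifford" is "Scal 0" .
lift_definition one_clifford :: "'a clifford" is "Scal 1" .
lift_definition plus_clifford :: "'a clifford \<Rightarrow> 'a clifford \<Rightarrow> 'a clifford" is Plus
  by (rule cl_plus_cong)
lift_definition times_clifford :: "'a clifford \<Rightarrow> 'a clifford \<Rightarrow> 'a clifford" is Times
  by (rule cl_times_cong)
lift_definition uminus_clifford :: "'a clifford \<Rightarrow> 'a clifford" is "Times (Scal (-1))"
  by (intro cl_times_cong cl_refl)
lift_definition scaleR_clifford :: "real \<Rightarrow> 'a clifford \<Rightarrow> 'a clifford" is "\<lambda>a. Times (Scal a)"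
  by (intro cl_times_cong cl_refl)
definition minus_clifford :: "'a clifford \<Rightarrow> 'a clifford \<Rightarrow> 'a clifford"
  where "minus_clifford x y = x + - y"

instance
proof
  fix a b :: real and x y z :: "'a clifford"
  show "x + y + z = x + (y + z)" by transfer (rule cl_plus_assoc)
  show "x + y = y + x" by transfer (rule cl_plus_commute)
  show "0 + x = x" by transfer (rule cl_plus_zero)
  show "- x + x = 0" by transfer (rule cl_plus_minus)
  show "x - y = x + - y" by (rule minus_clifford_def)
  show "x * y * z = x * (y * z)" by transfer (rule cl_times_assoc)
  show "1 * x = x" by transfer (rule cl_times_one_left)
  show "x * 1 = x" by transfer (rule cl_times_one_right)
  show "(x + y) * z = x * z + y * z" by transfer (rule cl_distrib_right)
  show "x * (y + z) = x * y + x * z" by transfer (rule cl_distrib_left)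
  show "(0 :: 'a clifford) \<noteq> 1" by transfer (rule clifford_nontrivial)
  show "a *\<^sub>R (x + y) = a *\<^sub>R x + a *\<^sub>R y" by transfer (rule cl_distrib_left)
  show "(a + b) *\<^sub>R x = a *\<^sub>R x + b *\<^sub>R x"
    by transfer (rule cl_trans[OF cl_times_cong[OF cl_scal_plus cl_refl] cl_distrib_right])
  show "a *\<^sub>R b *\<^sub>R x = (a * b) *\<^sub>R x"
    by transfer (rule cl_trans[OF cl_sym[OF cl_times_assoc]
          cl_times_cong[OF cl_sym[OF cl_scal_times] cl_refl]])
  show "1 *\<^sub>R x = x" by transfer (rule cl_times_one_left)
  show "a *\<^sub>R x * y = a *\<^sub>R (x * y)" by transfer (rule cl_times_assoc)
  show "x * a *\<^sub>R y = a *\<^sub>R (x * y)"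
    by transfer (rule cl_trans[OF cl_sym[OF cl_times_assoc]
          cl_trans[OF cl_times_cong[OF cl_scal_central cl_refl] cl_times_assoc]])
qed

end

lemma linear_cl_vec: "linear (cl_vec :: 'e::euclidean_space \<Rightarrow> _)"
proof
  show "cl_vec (v + w) = cl_vec v + cl_vec w" for v w :: 'e by transfer (rule cl_vec_plus)
  show "cl_vec (a *\<^sub>R v) = a *\<^sub>R cl_vec v" for a and v :: 'e by transfer (rule cl_vec_scal)
qed

lemma of_real_clifford: "of_real a = abs_clifford (Scal a :: 'e::euclidean_space cl_term)"
  unfolding of_real_def one_clifford.abs_eq scaleR_clifford.abs_eq
  by (simp add: clifford.abs_eq_iff cl_times_one_right)

lemma cl_vec_square: "cl_vec v * cl_vec v = of_real (- \<langle>v,v\<rangle>)"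
  unfolding of_real_clifford by transfer (rule cl_clifford)

lemma clifford_induct [case_names scal vec plus times]:
  fixes P :: "'e::euclidean_space clifford \<Rightarrow> bool"
  assumes "\<And>a. P (of_real a)" "\<And>v. P (cl_vec v)"
    "\<And>x y. P x \<Longrightarrow> P y \<Longrightarrow> P (x + y)" "\<And>x y. P x \<Longrightarrow> P y \<Longrightarrow> P (x * y)"
  shows "P x"
proof (induction x rule: clifford.abs_induct)
  fix t show "P (abs_clifford t)"
  proof (induction t)
    case (Scal a)
    then show ?case using assms(1) by (simp add: of_real_clifford)
  next
    case (Vec v)
    then show ?case using assms(2) by (simp add: cl_vec.abs_eq)
  next
    case (Plus x y)
    then show ?case using assms(3) by (metis plus_clifford.abs_eq)
  next
    case (Times x y)
    then show ?case using assms(4) by (metis times_clifford.abs_eq)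
  qed
qed

primrec term_eval :: "('e \<Rightarrow> 'a::real_algebra_1) \<Rightarrow> 'e cl_term \<Rightarrow> 'a" where
  "term_eval f (Scal a) = of_real a"
| "term_eval f (Vec v) = f v"
| "term_eval f (Plus x y) = term_eval f x + term_eval f y"
| "term_eval f (Times x y) = term_eval f x * term_eval f y"

definition cl_lift :: "('e::euclidean_space \<Rightarrow> 'a::real_algebra_1) \<Rightarrow> 'e clifford \<Rightarrow> 'a"
  where "cl_lift f x = term_eval f (rep_clifford x)"

lemma cl_lift:
  fixes f :: "'e::euclidean_space \<Rightarrow> 'a::real_algebra_1"
  assumes f: "linear f" and sq: "\<And>v. f v * f v = of_real (- \<langle>v,v\<rangle>)"
  shows "cl_lift f (cl_vec v) = f v" and "linear (cl_lift f)"
    and "cl_lift f 1 = 1" and "cl_lift f (x * y) = cl_lift f x * cl_lift f y"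
proof -
  have "cl_eq s t \<Longrightarrow> term_eval f s = term_eval f t" for s t
    by (induction rule: cl_eq.induct)
      (auto simp: distrib_left distrib_right scaleR_add_left mult.assoc linear_add[OF f] linear_cmul[OF f] sq of_real_def)
  then have E: "cl_lift f (abs_clifford t) = term_eval f t" for t
    unfolding cl_lift_def by (metis Quotient3_clifford Quotient3_rep_abs cl_refl)
  show "cl_lift f (cl_vec v) = f v" by (simp add: cl_vec.abs_eq E)
  show "cl_lift f 1 = 1" by (simp add: one_clifford.abs_eq E)
  show "cl_lift f (x * y) = cl_lift f x * cl_lift f y"
    by (induction x rule: clifford.abs_induct; induction y rule: clifford.abs_induct)
      (simp add: times_clifford.abs_eq E)
  show "linear (cl_lift f)"
  proof
    show "cl_lift f (x + y) = cl_lift f x + cl_lift f y" for x y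
      by (induction x rule: clifford.abs_induct; induction y rule: clifford.abs_induct)
        (simp add: plus_clifford.abs_eq E)
    show "cl_lift f (a *\<^sub>R x) = a *\<^sub>R cl_lift f x" for a x
      by (induction x rule: clifford.abs_induct) (simp add: scaleR_clifford.abs_eq E flip: scaleR_conv_of_real)
  qed
qed

lemma cl_hom_unique:
  fixes F G :: "'e::euclidean_space clifford \<Rightarrow> 'a::real_algebra_1"
  assumes "linear F" "F 1 = 1" "\<And>x y. F (x * y) = F x * F y"
    and "linear G" "G 1 = 1" "\<And>x y. G (x * y) = G x * G y"
    and "\<And>v. F (cl_vec v) = G (cl_vec v)"
  shows "F = G"
proof
  fix x show "F x = G x"
    by (induction x rule: clifford_induct)
      (simp_all add: assms(2,3,5,6,7) of_real_def linear_cmul[OF assms(1)] linear_cmul[OF assms(4)]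
        linear_add[OF assms(1)] linear_add[OF assms(4)])
qed

text \<open>The parity automorphism \<open>\<alpha>\<close>: the algebra endomorphism extending \<open>v \<mapsto> -v\<close>.\<close>

definition parity :: "'e::euclidean_space clifford \<Rightarrow> 'e clifford"
  where "parity = cl_lift (\<lambda>v. - cl_vec v)"

lemma parity:
  fixes v :: "'e::euclidean_space"
  shows "parity (cl_vec v) = - cl_vec v" and "linear (parity :: 'e clifford \<Rightarrow> _)"
    and "parity (1 :: 'e clifford) = 1" and "parity (x * y) = parity x * parity (y :: 'e clifford)"
proof -
  have "linear (\<lambda>v :: 'e. - cl_vec v)"
    using linear_cl_vec by (rule linear_compose_neg)
  note * = cl_lift[OF this, unfolded parity_def[symmetric]]
  show "parity (cl_vec v) = - cl_vec v" "linear (parity :: 'e clifford \<Rightarrow> _)"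
    "parity (1 :: 'e clifford) = 1" "parity (x * y) = parity x * parity (y :: 'e clifford)"
    by (rule *, simp add: cl_vec_square)+
qed

definition left_mult :: "'e::euclidean_space clifford \<Rightarrow> 'e clifford \<Rightarrow> 'e clifford"
  where "left_mult c x = c * x"

definition right_mult :: "'e::euclidean_space clifford \<Rightarrow> 'e clifford \<Rightarrow> 'e clifford"
  where "right_mult c x = x * c"

definition quadratic_clifford_equation ::
    "('e::euclidean_space \<Rightarrow> 'e) \<Rightarrow> 'e clifford \<Rightarrow> 'e clifford \<Rightarrow> bool"
  where "quadratic_clifford_equation B c1 c2 \<longleftrightarrow>
    (let D = (\<lambda>x. left_mult c1 x - right_mult c2 x)
     in (D ^^ 2) ` range cl_vec \<subseteq> range cl_vec \<and> (\<forall>e. (D ^^ 2) (cl_vec e) = - cl_vec (B e)))"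


section \<open>Spinors and admissible bilinear forms\<close>

definition invariant_subspace :: "('s::real_vector \<Rightarrow> 's) set \<Rightarrow> 's set \<Rightarrow> bool"
  where "invariant_subspace \<A> W \<longleftrightarrow> subspace W \<and> (\<forall>f\<in>\<A>. f ` W \<subseteq> W)"

definition irreducible_submodule :: "('s::real_vector \<Rightarrow> 's) set \<Rightarrow> 's set \<Rightarrow> bool"
  where "irreducible_submodule \<A> W \<longleftrightarrow>
    invariant_subspace \<A> W \<and> W \<noteq> {0} \<and>
    (\<forall>U. invariant_subspace \<A> U \<longrightarrow> U \<subseteq> W \<longrightarrow> U = {0} \<or> U = W)"

definition clifford_representation :: "('e::euclidean_space clifford \<Rightarrow> 's::real_vector \<Rightarrow> 's) \<Rightarrow> bool"
  where "clifford_representation \<rho> \<longleftrightarrow>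
    (\<forall>c. linear (\<rho> c)) \<and> (\<forall>s. linear (\<lambda>c. \<rho> c s)) \<and>
    \<rho> 1 = id \<and> (\<forall>c d. \<rho> (c * d) = \<rho> c \<circ> \<rho> d)"

definition irreducible_representation :: "('e::euclidean_space clifford \<Rightarrow> 's::real_vector \<Rightarrow> 's) \<Rightarrow> bool"
  where "irreducible_representation \<rho> \<longleftrightarrow>
    clifford_representation \<rho> \<and> irreducible_submodule (range \<rho>) UNIV"

definition rep_kernel :: "('e::euclidean_space clifford \<Rightarrow> 's::real_vector \<Rightarrow> 's) \<Rightarrow> 'e clifford set"
  where "rep_kernel \<rho> = {c. \<rho> c = (\<lambda>s. 0)}"

text \<open>The image of \<open>so(E)\<close> in the Clifford algebra under \<open>v \<and> w \<mapsto> [v,w] / 4\<close>.\<close>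

definition so_clifford :: "'e::euclidean_space clifford set"
  where "so_clifford = span {(1/4) *\<^sub>R (cl_vec v * cl_vec w - cl_vec w * cl_vec v) | v w. True}"

text \<open>
  The last clause speaks of semi-spinors \<open>Sp\<close>, \<open>Sm\<close>.  In the dimensions where these are equivalent
  \<open>so(E)\<close>-modules the splitting of the spinor module into irreducible summands is not unique, and
  the clause asks for some such splitting.
\<close>

definition admissible_form ::
    "('e::euclidean_space clifford \<Rightarrow> 's::real_vector \<Rightarrow> 's) \<Rightarrow> real \<Rightarrow> real \<Rightarrow> ('s \<Rightarrow> 's \<Rightarrow> real) \<Rightarrow> bool"
  where "admissible_form \<rho> \<tau> \<sigma> \<Gamma> \<longleftrightarrow>
    bilinear \<Gamma> \<and>
    (\<forall>A\<in>so_clifford. \<forall>s t. \<Gamma> (\<rho> A s) t + \<Gamma> s (\<rho> A t) = 0) \<and>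
    \<tau> \<in> {1, -1} \<and> (\<forall>e s t. \<Gamma> (\<rho> (cl_vec e) s) t = \<tau> * \<Gamma> s (\<rho> (cl_vec e) t)) \<and>
    \<sigma> \<in> {1, -1} \<and> (\<forall>s t. \<Gamma> s t = \<sigma> * \<Gamma> t s) \<and>
    (\<not> irreducible_submodule (\<rho> ` so_clifford) UNIV \<longrightarrow>
      (\<exists>Sp Sm. irreducible_submodule (\<rho> ` so_clifford) Sp \<and>
        irreducible_submodule (\<rho> ` so_clifford) Sm \<and>
        Sp \<inter> Sm = {0} \<and> {x + y | x y. x \<in> Sp \<and> y \<in> Sm} = UNIV \<and>
        ((\<forall>x\<in>Sp. \<forall>y\<in>Sm. \<Gamma> x y = 0 \<and> \<Gamma> y x = 0) \<or>
         (\<forall>x\<in>Sp. \<forall>y\<in>Sp. \<Gamma> x y = 0) \<and> (\<forall>x\<in>Sm. \<forall>y\<in>Sm. \<Gamma> x y = 0))))"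

definition bil_minus ::
    "('e::euclidean_space clifford \<Rightarrow> 's::real_vector \<Rightarrow> 's) \<Rightarrow> ('s \<Rightarrow> 's \<Rightarrow> real) set"
  where "bil_minus \<rho> = {(\<lambda>s t. \<Sum>\<Gamma>\<in>F. a \<Gamma> * \<Gamma> s t) | F a.
    finite F \<and> (\<forall>\<Gamma>\<in>F. \<exists>\<tau> \<sigma>. admissible_form \<rho> \<tau> \<sigma> \<Gamma> \<and> \<tau> * \<sigma> = -1)}"

definition symmetric_forms :: "('s::real_vector \<Rightarrow> 's \<Rightarrow> real) set"
  where "symmetric_forms = {\<Gamma>. bilinear \<Gamma> \<and> (\<forall>s t. \<Gamma> s t = \<Gamma> t s)}"


section \<open>The Cahen-Wallach algebra\<close>

text \<open>
  A quadruple \<open>(\<phi>, e, x, y)\<close> stands for \<open>\<phi> + e + x p + y q\<close> in \<open>E\<^sup>* + (E + R p + R q)\<close>.  As \<open>E\<close> has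
  finite dimension, \<open>E\<^sup>*\<close> is the type of bounded linear functionals.
\<close>

type_synonym 'e cw = "('e \<Rightarrow>\<^sub>L real) \<times> 'e \<times> real \<times> real"

definition flat :: "'e::euclidean_space \<Rightarrow> 'e \<Rightarrow>\<^sub>L real"
  where "flat e = Blinfun (\<lambda>f. \<langle>e,f\<rangle>)"

definition sharp :: "('e::euclidean_space \<Rightarrow>\<^sub>L real) \<Rightarrow> 'e"
  where "sharp = inv flat"

lemma flat_apply: "blinfun_apply (flat e) f = \<langle>e,f\<rangle>"
  unfolding flat_def ip_def
  by (subst bounded_linear_Blinfun_apply) (auto intro!: bounded_linear_minus bounded_linear_inner_right)

lemma bij_flat: "bij (flat :: 'e::euclidean_space \<Rightarrow> _)"
proof (rule bijI)
  show "inj (flat :: 'e \<Rightarrow> _)"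
  proof (rule injI)
    fix e f :: 'e
    assume "flat e = flat f"
    then have "\<langle>e,x\<rangle> = \<langle>f,x\<rangle>" for x by (metis flat_apply)
    then show "e = f" by (rule ip_eqI)
  qed
  show "surj (flat :: 'e \<Rightarrow> _)"
  proof (rule surjI)
    fix \<phi> :: "'e \<Rightarrow>\<^sub>L real"
    show "flat (- (\<Sum>i\<in>Basis. blinfun_apply \<phi> i *\<^sub>R i)) = \<phi>"
    proof (rule blinfun_eqI)
      fix x
      have "blinfun_apply \<phi> x = blinfun_apply \<phi> (\<Sum>i\<in>Basis. (x \<bullet> i) *\<^sub>R i)"
        by (simp add: euclidean_representation)
      then show "blinfun_apply (flat (- (\<Sum>i\<in>Basis. blinfun_apply \<phi> i *\<^sub>R i))) x = blinfun_apply \<phi> x"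
        by (simp add: flat_apply ip_def inner_sum_left inner_sum_right blinfun.sum_right
            blinfun.scaleR_right inner_commute mult.commute)
    qed
  qed
qed

definition cw_dual :: "('e::euclidean_space \<Rightarrow>\<^sub>L real) \<Rightarrow> 'e cw"
  where "cw_dual \<phi> = (\<phi>, 0, 0, 0)"

definition cw_vec :: "'e::euclidean_space \<Rightarrow> 'e cw"
  where "cw_vec e = (0, e, 0, 0)"

definition cw_p :: "'e::euclidean_space cw"
  where "cw_p = (0, 0, 1, 0)"

definition cw_q :: "'e::euclidean_space cw"
  where "cw_q = (0, 0, 0, 1)"

definition cw_m :: "'e::euclidean_space cw set"
  where "cw_m = {X. fst X = 0}"

text \<open>The bilinear skew extension of the brackets \<open>[q,e]\<close>, \<open>[e\<^sup>\<flat>,f]\<close>, \<open>[e\<^sup>\<flat>,q]\<close> of \<open>cw_brackets\<close> below.\<close>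

definition cw_bracket ::
    "('e::euclidean_space \<Rightarrow> 'e \<Rightarrow> real) \<Rightarrow> ('e \<Rightarrow> 'e) \<Rightarrow> 'e cw \<Rightarrow> 'e cw \<Rightarrow> 'e cw"
  where "cw_bracket b B = (\<lambda>(\<phi>, e, x, y) (\<phi>', e', x', y').
    (y *\<^sub>R flat e' - y' *\<^sub>R flat e,
     y' *\<^sub>R B (sharp \<phi>) - y *\<^sub>R B (sharp \<phi>'),
     b (sharp \<phi>) e' - b (sharp \<phi>') e,
     0))"

definition nondegenerate_symmetric_form :: "('e::euclidean_space \<Rightarrow> 'e \<Rightarrow> real) \<Rightarrow> bool"
  where "nondegenerate_symmetric_form b \<longleftrightarrow>
    bilinear b \<and> (\<forall>e f. b e f = b f e) \<and> (\<forall>e. (\<forall>f. b e f = 0) \<longrightarrow> e = 0)"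

lemma sharp_flat [simp]: "sharp (flat e) = e" "flat (sharp \<phi>) = \<phi>"
  by (simp_all add: sharp_def bij_flat bij_is_inj bij_is_surj surj_f_inv_f)

lemma sharp_zero [simp]: "sharp 0 = 0"
proof -
  have "flat 0 = (0 :: 'a \<Rightarrow>\<^sub>L real)"
    by (rule blinfun_eqI) (simp add: flat_apply ip_def)
  then show ?thesis by (metis sharp_flat(1))
qed

lemma cw_brackets:
  assumes b: "nondegenerate_symmetric_form b" and B: "\<And>e f. b e f = - \<langle>B e,f\<rangle>"
  shows "cw_bracket b B cw_q (cw_vec e) = cw_dual (flat e)"
    and "cw_bracket b B (cw_dual (flat e)) (cw_vec f) = b e f *\<^sub>R cw_p"
    and "cw_bracket b B (cw_dual (flat e)) cw_q = cw_vec (B e)"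
    and "cw_bracket b B X Y = - cw_bracket b B Y X"
    and "cw_bracket b B cw_p X = 0"
    and "cw_bracket b B (cw_vec e) (cw_vec f) = 0"
    and "cw_bracket b B (cw_dual \<phi>) (cw_dual \<psi>) = 0"
    and "bilinear (cw_bracket b B)"
proof -
  have bil: "bilinear b" using b by (simp add: nondegenerate_symmetric_form_def)
  have b0: "b 0 x = 0" "b x 0 = 0" for x
    by (simp_all add: bilinear_lzero[OF bil] bilinear_rzero[OF bil])
  have linB: "linear B"
  proof
    show "B (x + y) = B x + B y" for x y
    proof (rule ip_eqI)
      fix f
      show "\<langle>B (x + y),f\<rangle> = \<langle>B x + B y,f\<rangle>"
        using bilinear_ladd[OF bil, of x y f] unfolding B by (simp add: ip_def inner_add_left)
    qed
    show "B (a *\<^sub>R x) = a *\<^sub>R B x" for a x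
    proof (rule ip_eqI)
      fix f
      show "\<langle>B (a *\<^sub>R x),f\<rangle> = \<langle>a *\<^sub>R B x,f\<rangle>"
        using bilinear_lmul[OF bil, of a x f] unfolding B by (simp add: ip_def)
    qed
  qed
  have lin_flat: "linear (flat :: 'a \<Rightarrow> _)"
    by standard (auto intro!: blinfun_eqI
        simp: flat_apply ip_def inner_add_left blinfun.add_left blinfun.scaleR_left)
  have lin_sharp: "linear (sharp :: _ \<Rightarrow> 'a)"
  proof
    show "sharp (\<phi> + \<psi>) = sharp \<phi> + sharp \<psi>" for \<phi> \<psi> :: "'a \<Rightarrow>\<^sub>L real"
      by (metis linear_add[OF lin_flat] sharp_flat)
    show "sharp (a *\<^sub>R \<phi>) = a *\<^sub>R sharp \<phi>" for a and \<phi> :: "'a \<Rightarrow>\<^sub>L real"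
      by (metis linear_cmul[OF lin_flat] sharp_flat)
  qed
  note lins = linear_0[OF linB] linear_0[OF lin_flat] linear_add[OF linB] linear_cmul[OF linB]
    linear_add[OF lin_flat] linear_cmul[OF lin_flat] linear_add[OF lin_sharp]
    linear_cmul[OF lin_sharp] bilinear_ladd[OF bil] bilinear_radd[OF bil]
    bilinear_lmul[OF bil] bilinear_rmul[OF bil] b0
  note defs = cw_bracket_def cw_q_def cw_p_def cw_vec_def cw_dual_def zero_prod_def
  show "cw_bracket b B cw_q (cw_vec e) = cw_dual (flat e)"
    "cw_bracket b B (cw_dual (flat e)) (cw_vec f) = b e f *\<^sub>R cw_p"
    "cw_bracket b B (cw_dual (flat e)) cw_q = cw_vec (B e)"
    "cw_bracket b B (cw_vec e) (cw_vec f) = 0"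
    "cw_bracket b B (cw_dual \<phi>) (cw_dual \<psi>) = 0"
    by (simp_all add: defs lins)
  show "cw_bracket b B cw_p X = 0" by (cases X) (simp add: defs lins)
  show "cw_bracket b B X Y = - cw_bracket b B Y X"
    by (cases X; cases Y) (simp add: defs)
  show "bilinear (cw_bracket b B)"
    unfolding bilinear_def
    by (intro conjI allI linearI)
      (auto simp: cw_bracket_def lins algebra_simps split: prod.splits)
qed


section \<open>Spin representations and superizations\<close>

text \<open>\<open>S = S\<^sub>- + S\<^sub>+\<close> is the type \<open>'s \<times> 's\<close>; block matrices act on columns \<open>(Q\<^sub>-, Q\<^sub>+)\<close>.\<close>

definition block ::
    "('s \<Rightarrow> 's) \<Rightarrow> ('s \<Rightarrow> 's) \<Rightarrow> ('s \<Rightarrow> 's) \<Rightarrow> ('s \<Rightarrow> 's) \<Rightarrow> 's \<times> 's \<Rightarrow> 's \<times> ('s::real_vector)"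
  where "block f\<^sub>1\<^sub>1 f\<^sub>1\<^sub>2 f\<^sub>2\<^sub>1 f\<^sub>2\<^sub>2 = (\<lambda>(Qm, Qp). (f\<^sub>1\<^sub>1 Qm + f\<^sub>1\<^sub>2 Qp, f\<^sub>2\<^sub>1 Qm + f\<^sub>2\<^sub>2 Qp))"

text \<open>
  The quadruple \<open>(c\<^sub>0, c\<^sub>p, c\<^sub>q, c\<^sub>p\<^sub>q)\<close> stands for the element
  \<open>1 \<otimes> c\<^sub>0 + p \<otimes> c\<^sub>p + q \<otimes> c\<^sub>q + pq \<otimes> c\<^sub>p\<^sub>q\<close> of \<open>Cl(m)\<close>, identified with the graded tensor product
  of the Clifford algebras of \<open>R p + R q\<close> and \<open>E\<close>.
\<close>

definition rho_spin ::
    "('e::euclidean_space clifford \<Rightarrow> 's::real_vector \<Rightarrow> 's) \<Rightarrow>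
     'e clifford \<times> 'e clifford \<times> 'e clifford \<times> 'e clifford \<Rightarrow> 's \<times> 's \<Rightarrow> 's \<times> 's"
  where "rho_spin \<rho> = (\<lambda>(c\<^sub>0, c\<^sub>p, c\<^sub>q, c\<^sub>p\<^sub>q) Q.
      block (\<rho> (parity c\<^sub>0)) (\<lambda>s. 0) (\<lambda>s. 0) (\<rho> c\<^sub>0) Q
    + block (\<lambda>s. 0) (\<lambda>s. (2 * sqrt 2) *\<^sub>R \<rho> c\<^sub>p s) (\<lambda>s. 0) (\<lambda>s. 0) Q
    + block (\<lambda>s. 0) (\<lambda>s. 0) (\<lambda>s. - (1 / sqrt 2) *\<^sub>R \<rho> (parity c\<^sub>q) s) (\<lambda>s. 0) Q
    + block (\<lambda>s. - 2 *\<^sub>R \<rho> (parity c\<^sub>p\<^sub>q) s) (\<lambda>s. 0) (\<lambda>s. 0) (\<lambda>s. 0) Q)"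

definition lie_representation ::
    "('g::real_vector \<Rightarrow> 'g \<Rightarrow> 'g) \<Rightarrow> ('g \<Rightarrow> 'v::real_vector \<Rightarrow> 'v) \<Rightarrow> bool"
  where "lie_representation lb R \<longleftrightarrow>
    (\<forall>X. linear (R X)) \<and> (\<forall>v. linear (\<lambda>X. R X v)) \<and>
    (\<forall>X Y v. R (lb X Y) v = R X (R Y v) - R Y (R X v))"

definition spin_representation ::
    "('e::euclidean_space clifford \<Rightarrow> 's::real_vector \<Rightarrow> 's) \<Rightarrow> ('e \<Rightarrow> 'e \<Rightarrow> real) \<Rightarrow> ('e \<Rightarrow> 'e) \<Rightarrow>
     ('e cw \<Rightarrow> 's \<times> 's \<Rightarrow> 's \<times> 's) \<Rightarrow> bool"
  where "spin_representation \<rho> b B R \<longleftrightarrow>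
    lie_representation (cw_bracket b B) R \<and>
    (\<forall>e. R (cw_dual (flat e)) =
      block (\<lambda>s. 0) (\<lambda>s. sqrt 2 *\<^sub>R \<rho> (cl_vec (B e)) s) (\<lambda>s. 0) (\<lambda>s. 0))"

definition zero_charge_spin_representation ::
    "('e::euclidean_space clifford \<Rightarrow> 's::real_vector \<Rightarrow> 's) \<Rightarrow> ('e \<Rightarrow> 'e \<Rightarrow> real) \<Rightarrow> ('e \<Rightarrow> 'e) \<Rightarrow>
     ('e cw \<Rightarrow> 's \<times> 's \<Rightarrow> 's \<times> 's) \<Rightarrow> bool"
  where "zero_charge_spin_representation \<rho> b B R \<longleftrightarrow>
    spin_representation \<rho> b B R \<and> R cw_p = (\<lambda>Q. 0) \<and> R ` cw_m \<subseteq> range (rho_spin \<rho>)"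

definition homogeneous :: "nat \<Rightarrow> ('a::real_vector \<times> 'b::real_vector) set"
  where "homogeneous i = (if even i then UNIV \<times> {0} else {0} \<times> UNIV)"

text \<open>A Lie superalgebra structure on the direct sum of the even part \<open>'a\<close> and the odd part \<open>'b\<close>.\<close>

definition lie_superalgebra ::
    "('a::real_vector \<times> 'b::real_vector \<Rightarrow> 'a \<times> 'b \<Rightarrow> 'a \<times> 'b) \<Rightarrow> bool"
  where "lie_superalgebra br \<longleftrightarrow>
    bilinear br \<and>
    (\<forall>i j. \<forall>x\<in>homogeneous i. \<forall>y\<in>homogeneous j. br x y \<in> homogeneous (i + j)) \<and>
    (\<forall>i\<in>{0,1}. \<forall>j\<in>{0,1}. \<forall>x\<in>homogeneous i. \<forall>y\<in>homogeneous j.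
      br x y = - ((-1) ^ (i * j) *\<^sub>R br y x)) \<and>
    (\<forall>i\<in>{0,1}. \<forall>j\<in>{0,1}. \<forall>x\<in>homogeneous i. \<forall>y\<in>homogeneous j. \<forall>z.
      br x (br y z) = br (br x y) z + (-1) ^ (i * j) *\<^sub>R br y (br x z))"

definition ad_odd ::
    "('a::real_vector \<times> 'b::real_vector \<Rightarrow> 'a \<times> 'b \<Rightarrow> 'a \<times> 'b) \<Rightarrow> 'a \<Rightarrow> 'b \<Rightarrow> 'b"
  where "ad_odd br X Q = snd (br (X, 0) (0, Q))"

definition zero_charge_superization ::
    "('e::euclidean_space clifford \<Rightarrow> 's::real_vector \<Rightarrow> 's) \<Rightarrow> ('e \<Rightarrow> 'e \<Rightarrow> real) \<Rightarrow> ('e \<Rightarrow> 'e) \<Rightarrow>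
     ('e cw \<times> ('s \<times> 's) \<Rightarrow> 'e cw \<times> ('s \<times> 's) \<Rightarrow> 'e cw \<times> ('s \<times> 's)) \<Rightarrow> bool"
  where "zero_charge_superization \<rho> b B br \<longleftrightarrow>
    lie_superalgebra br \<and>
    (\<forall>X Y. br (X, 0) (Y, 0) = (cw_bracket b B X Y, 0)) \<and>
    zero_charge_spin_representation \<rho> b B (ad_odd br)"

definition translational_supersymmetry ::
    "('e::euclidean_space cw \<times> 'v::real_vector \<Rightarrow> 'e cw \<times> 'v \<Rightarrow> 'e cw \<times> 'v) \<Rightarrow> bool"
  where "translational_supersymmetry br \<longleftrightarrow> (\<forall>Q Q'. br (0, Q) (0, Q') \<in> cw_m \<times> {0})"

definition superization_data ::
    "('e::euclidean_space clifford \<Rightarrow> 's::real_vector \<Rightarrow> 's) \<Rightarrow> ('e \<Rightarrow> 'e) \<Rightarrow>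
     'e clifford \<Rightarrow> 'e clifford \<Rightarrow> 'e clifford \<Rightarrow> ('s \<Rightarrow> 's \<Rightarrow> real) \<Rightarrow> ('s \<Rightarrow> 's \<Rightarrow> real) \<Rightarrow> bool"
  where "superization_data \<rho> B c1 c2 c3 pmp ppp \<longleftrightarrow>
    quadratic_clifford_equation B c1 c2 \<and>
    pmp \<in> bil_minus \<rho> \<and> ppp \<in> symmetric_forms \<and>
    (\<forall>s t. pmp (\<rho> c3 s) t + pmp (\<rho> c3 t) s + ppp (\<rho> c2 s) t + ppp s (\<rho> c2 t) = 0) \<and>
    (\<forall>s t. pmp (\<rho> c1 s) t + pmp s (\<rho> c2 t) = 0)"

definition superization_given_by ::
    "('e::euclidean_space clifford \<Rightarrow> 's::real_vector \<Rightarrow> 's) \<Rightarrow> ('e \<Rightarrow> 'e) \<Rightarrow>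
     'e clifford \<Rightarrow> 'e clifford \<Rightarrow> 'e clifford \<Rightarrow> ('s \<Rightarrow> 's \<Rightarrow> real) \<Rightarrow> ('s \<Rightarrow> 's \<Rightarrow> real) \<Rightarrow>
     ('e cw \<times> ('s \<times> 's) \<Rightarrow> 'e cw \<times> ('s \<times> 's) \<Rightarrow> 'e cw \<times> ('s \<times> 's)) \<Rightarrow> bool"
  where "superization_given_by \<rho> B c1 c2 c3 pmp ppp br \<longleftrightarrow>
    ad_odd br cw_p = block (\<lambda>s. 0) (\<lambda>s. 0) (\<lambda>s. 0) (\<lambda>s. 0) \<and>
    ad_odd br cw_q = block (\<rho> c1) (\<rho> c3) (\<lambda>s. 0) (\<rho> c2) \<and>
    (\<forall>e. ad_odd br (cw_dual (flat e)) =
      block (\<lambda>s. 0) (\<lambda>s. sqrt 2 *\<^sub>R \<rho> (cl_vec (B e)) s) (\<lambda>s. 0) (\<lambda>s. 0)) \<and>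
    (\<forall>e. ad_odd br (cw_vec e) =
      block (\<lambda>s. 0) (\<lambda>s. sqrt 2 *\<^sub>R (\<rho> (cl_vec e) (\<rho> c2 s) - \<rho> c1 (\<rho> (cl_vec e) s))) (\<lambda>s. 0) (\<lambda>s. 0)) \<and>
    (\<forall>Qm Qp. br (0, (Qm, Qp)) (0, (Qm, Qp)) =
      ((ppp Qp Qp + 2 * pmp Qm Qp) *\<^sub>R cw_p, 0))"

end

theory Submission
  imports Defs
begin

text \<open>
  Equivariance under the Cahen-Wallach algebra is computed with \<open>2 \<times> 2\<close> block matrices.  The
  bracket \<open>[e\<^sup>\<flat>, q] = B e\<close> expresses the action of \<open>E\<close> through that of \<open>q\<close>, because \<open>B\<close> is
  invertible; the remaining brackets make the matrix of \<open>q\<close> upper triangular and turn into the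
  quadratic equation for its diagonal (\<open>zero_charge_representation_form\<close>).  A bracket of odd
  elements with values in \<open>m\<close> is forced into \<open>\<real> p\<close>, and its invariance under \<open>E\<^sup>*\<close> and \<open>q\<close> is
  the condition \<open>\<tau>\<sigma> = -1\<close> together with the compatibility conditions
  (\<open>superization_classified\<close>).  Conversely the same identities verify all axioms
  (\<open>superization_correct\<close>).  The Jacobi identity for three odd elements is automatic, since \<open>p\<close> acts
  by zero on the spinors.

  Two points lie deeper than this computation.

  First, the representation gives the quadratic equation only in \<open>\<rho>(Cl)\<close>, whereas it is asserted in
  the Clifford algebra itself, and \<open>\<rho>\<close> may have a kernel.  The Clifford algebra has no proper
  nonzero graded ideals (\<open>graded_ideal_trivial\<close>); so if the kernel \<open>K\<close> is nonzero, the algebra is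
  the product of its quotients by \<open>K\<close> and \<open>\<alpha>(K)\<close>, and a solution modulo \<open>K\<close>, paired with its
  image under \<open>\<alpha>\<close>, is an exact solution (\<open>quadratic_clifford_equation_lift\<close>).

  Second, invariance gives the identity \<open>\<beta>(e s, t) = - \<beta>(e t, s)\<close>, whereas the theorem speaks of
  spans of admissible forms, which involve semi-spinors.  The two agree in every dimension
  (\<open>bil_minus_iff\<close>): the symmetric and the skew part of \<open>\<beta>\<close> satisfy the same identity, and for any
  form with a type and a symmetry the semi-spinors can be chosen mutually orthogonal or both isotropic
  (\<open>semi_spinor_splitting\<close>).  This rests on the fact that \<open>S = U + e U\<close> is a direct sum for every
  proper nonzero \<open>so(E)\<close>-submodule \<open>U\<close> and every unit vector \<open>e\<close>.
\<close>

section \<open>The Clifford algebra is simple as a superalgebra\<close>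

lemma cl_vec_anticommute:
  "cl_vec v * cl_vec w + cl_vec w * cl_vec v = of_real (2 * (v \<bullet> w))"
proof -
  have "cl_vec (v + w) * cl_vec (v + w) = of_real ((v + w) \<bullet> (v + w))"
    by (simp add: cl_vec_square ip_def)
  then show ?thesis
    using cl_vec_square[of v] cl_vec_square[of w]
    by (simp add: linear_add[OF linear_cl_vec] ip_def inner_add_left inner_add_right
        inner_commute[of w v] algebra_simps flip: of_real_mult)
qed

lemma parity_parity [simp]: "parity (parity x) = x"
proof (induction x rule: clifford_induct)
  case (scal a)
  then show ?case by (simp add: of_real_def linear_cmul[OF parity(2)] parity(3))
next
  case (vec v)
  then show ?case by (simp add: parity(1) linear_neg[OF parity(2)])
next
  case (plus x y)
  then show ?case by (simp add: linear_add[OF parity(2)])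
next
  case (times x y)
  then show ?case by (simp add: parity(4))
qed

primrec monomials :: "'e::euclidean_space list \<Rightarrow> 'e clifford set" where
  "monomials [] = {1}"
| "monomials (b # bs) = monomials bs \<union> (\<lambda>x. cl_vec b * x) ` monomials bs"

lemma finite_monomials: "finite (monomials bs)"
  by (induction bs) auto

lemma span_monomials_Cons:
  "span (monomials (b # bs)) = {x + cl_vec b * y | x y. x \<in> span (monomials bs) \<and> y \<in> span (monomials bs)}"
proof -
  have "linear (\<lambda>x. cl_vec b * x)"
    by (simp add: linearI distrib_left)
  then show ?thesis
    by (auto simp: span_Un linear_span_image)
qed

text \<open>
  A basis vector \<open>b\<close> anticommutes with every other one, so it passes an element built from the
  others at the price of the parity automorphism.
\<close>

lemma supercommute_span_monomials:
  assumes "x \<in> span (monomials bs)" "b \<in> Basis" "set bs \<subseteq> Basis" "b \<notin> set bs"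
  shows "cl_vec b * parity x = x * cl_vec b"
  using assms
proof (induction bs arbitrary: x)
  case Nil
  then obtain r where "x = r *\<^sub>R 1"
    by (auto simp: span_singleton)
  then show ?case by (simp add: linear_cmul[OF parity(2)] parity(3))
next
  case (Cons c bs)
  then obtain y z where x: "x = y + cl_vec c * z"
    and "y \<in> span (monomials bs)" "z \<in> span (monomials bs)"
    unfolding span_monomials_Cons by blast
  with Cons have IH: "cl_vec b * parity y = y * cl_vec b" "cl_vec b * parity z = z * cl_vec b"
    by simp_all
  have "b \<bullet> c = 0"
    using Cons.prems by (auto simp: inner_Basis)
  then have anti: "cl_vec b * cl_vec c = - (cl_vec c * cl_vec b)"
    using cl_vec_anticommute[of b c] by (simp add: eq_neg_iff_add_eq_0)
  have "cl_vec b * parity x = cl_vec b * parity y - (cl_vec b * cl_vec c) * parity z"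
    by (simp add: x linear_add[OF parity(2)] parity algebra_simps)
  then show ?case by (simp add: anti IH x algebra_simps)
qed

lemma Basis_square: "b \<in> Basis \<Longrightarrow> cl_vec b * (cl_vec b * x) = x"
  using cl_vec_square[of b] by (simp add: ip_def inner_Basis flip: mult.assoc)

lemma vec_mult_span_monomials:
  assumes "x \<in> span (monomials bs)" "c \<in> set bs" "set bs \<subseteq> Basis"
  shows "cl_vec c * x \<in> span (monomials bs)"
  using assms
proof (induction bs arbitrary: x)
  case (Cons b bs)
  then obtain y z where x: "x = y + cl_vec b * z"
    and yz: "y \<in> span (monomials bs)" "z \<in> span (monomials bs)"
    unfolding span_monomials_Cons by blast
  show ?case
  proof (cases "c = b")
    case True
    then have "cl_vec c * x = z + cl_vec b * y"
      using Cons.prems by (simp add: x distrib_left Basis_square)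
    with yz show ?thesis unfolding span_monomials_Cons by blast
  next
    case False
    then have "c \<bullet> b = 0"
      using Cons.prems by (auto simp: inner_Basis)
    then have anti: "cl_vec c * cl_vec b = - (cl_vec b * cl_vec c)"
      using cl_vec_anticommute[of c b] by (simp add: eq_neg_iff_add_eq_0)
    have "cl_vec c * x = cl_vec c * y + (cl_vec c * cl_vec b) * z"
      by (simp add: x algebra_simps)
    also have "\<dots> = cl_vec c * y + cl_vec b * (- (cl_vec c * z))"
      by (simp add: anti algebra_simps)
    finally have *: "cl_vec c * x = cl_vec c * y + cl_vec b * (- (cl_vec c * z))" .
    have "cl_vec c * y \<in> span (monomials bs)" "- (cl_vec c * z) \<in> span (monomials bs)"
      using Cons False yz by (simp_all add: span_neg)
    with * show ?thesis unfolding span_monomials_Cons by blast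
  qed
qed simp

text \<open>
  The span contains \<open>1\<close> and is stable under left multiplication by the generators, hence by
  everything.
\<close>

lemma span_monomials_Basis:
  fixes bs :: "'e::euclidean_space list"
  assumes bs: "set bs = Basis"
  shows "span (monomials bs) = UNIV"
proof -
  have one: "1 \<in> span (monomials bs)"
    by (rule span_base, induction bs) auto
  have "\<forall>x\<in>span (monomials bs). c * x \<in> span (monomials bs)" for c :: "'e clifford"
  proof (induction c rule: clifford_induct)
    case (scal a)
    then show ?case by (simp add: span_scale flip: scaleR_conv_of_real)
  next
    case (vec v)
    show ?case
    proof
      fix x assume x: "x \<in> span (monomials bs)"
      have "cl_vec v = cl_vec (\<Sum>b\<in>Basis. (v \<bullet> b) *\<^sub>R b)"
        by (simp add: euclidean_representation)
      also have "\<dots> = (\<Sum>b\<in>Basis. (v \<bullet> b) *\<^sub>R cl_vec b)"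
        by (simp add: linear_sum[OF linear_cl_vec] linear_cmul[OF linear_cl_vec])
      finally have "cl_vec v * x = (\<Sum>b\<in>Basis. (v \<bullet> b) *\<^sub>R (cl_vec b * x))"
        by (simp add: sum_distrib_right)
      then show "cl_vec v * x \<in> span (monomials bs)"
        using x bs by (auto intro!: span_sum span_scale vec_mult_span_monomials)
    qed
  qed (simp_all add: distrib_right span_add mult.assoc)
  then show ?thesis using one by (metis UNIV_eq_I mult.right_neutral)
qed

lemma clifford_finite_dimensional:
  obtains M :: "'e::euclidean_space clifford set" where "finite M" "span M = UNIV"
  using finite_monomials span_monomials_Basis finite_list[OF finite_Basis] by metis

definition two_sided_ideal :: "'a::real_algebra_1 set \<Rightarrow> bool"
  where "two_sided_ideal I \<longleftrightarrow> subspace I \<and> (\<forall>x\<in>I. \<forall>c. c * x \<in> I \<and> x * c \<in> I)"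

lemma two_sided_idealD:
  assumes "two_sided_ideal I"
  shows "0 \<in> I" "x \<in> I \<Longrightarrow> y \<in> I \<Longrightarrow> x + y \<in> I" "x \<in> I \<Longrightarrow> y \<in> I \<Longrightarrow> x - y \<in> I"
    "x \<in> I \<Longrightarrow> - x \<in> I" "x \<in> I \<Longrightarrow> a *\<^sub>R x \<in> I" "x \<in> I \<Longrightarrow> c * x \<in> I" "x \<in> I \<Longrightarrow> x * c \<in> I"
  using assms
  by (simp_all add: two_sided_ideal_def subspace_0 subspace_add subspace_diff subspace_neg
      subspace_scale)

text \<open>
  The map \<open>x \<mapsto> (x + b \<alpha>(x) b)/2\<close> fixes the elements that do not involve the unit vector \<open>b\<close> and
  kills the multiples \<open>b y\<close> of such elements, because \<open>b\<close> supercommutes with them.  It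
  preserves a graded ideal.  Hence if \<open>y + b z\<close> lies in the ideal, so do \<open>y\<close> and \<open>b z\<close>, and then
  \<open>z = b (b z)\<close>; removing the basis vectors one after the other leaves scalars, and a nonzero
  scalar in the ideal makes it everything.
\<close>

lemma graded_ideal_trivial:
  fixes I :: "'e::euclidean_space clifford set"
  assumes I: "two_sided_ideal I" and gr: "parity ` I \<subseteq> I"
  shows "I = {0} \<or> I = UNIV"
proof (cases "1 \<in> I")
  case True
  then have "c \<in> I" for c
    using two_sided_idealD(6)[OF I, of 1 c] by simp
  then show ?thesis by auto
next
  case False
  have ker: "x \<in> I \<Longrightarrow> x \<in> span (monomials bs) \<Longrightarrow> x = 0"
    if "set bs \<subseteq> Basis" "distinct bs" for bs and x :: "'e clifford"
    using that
  proof (induction bs arbitrary: x)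
    case Nil
    then obtain r where x: "x = r *\<^sub>R 1"
      by (auto simp: span_singleton)
    have "r = 0"
    proof (rule ccontr)
      assume "r \<noteq> 0"
      then have "1 = inverse r *\<^sub>R x" by (simp add: x)
      with False Nil.prems(1) two_sided_idealD(5)[OF I] show False by metis
    qed
    then show ?case by (simp add: x)
  next
    case (Cons b bs)
    then have b: "b \<in> Basis" "b \<notin> set bs" and bs: "set bs \<subseteq> Basis" "distinct bs" by auto
    obtain y z where x: "x = y + cl_vec b * z"
      and yz: "y \<in> span (monomials bs)" "z \<in> span (monomials bs)"
      using Cons.prems unfolding span_monomials_Cons by blast
    note sc = supercommute_span_monomials[OF _ b(1) bs(1) b(2)]
    have bb: "cl_vec b * cl_vec b = 1"
      using b Basis_square[of b 1] by simp
    have "cl_vec b * parity x * cl_vec b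
        = (cl_vec b * parity y) * cl_vec b - cl_vec b * cl_vec b * parity z * cl_vec b"
      by (simp add: x linear_add[OF parity(2)] parity algebra_simps)
    also have "(cl_vec b * parity y) * cl_vec b = y"
      by (simp add: sc[OF yz(1)] mult.assoc bb)
    also have "cl_vec b * cl_vec b * parity z * cl_vec b = cl_vec b * (cl_vec b * parity z) * cl_vec b"
      by (simp add: mult.assoc)
    also have "\<dots> = cl_vec b * z"
      by (simp add: sc[OF yz(2)] mult.assoc bb)
    finally have "y = (1 / 2) *\<^sub>R (x + cl_vec b * parity x * cl_vec b)"
      by (simp add: x flip: scaleR_2)
    moreover have "parity x \<in> I" using gr Cons.prems by auto
    ultimately have "y \<in> I"
      using Cons.prems(1) by (simp add: two_sided_idealD[OF I])
    then have y0: "y = 0" using Cons.IH yz bs by blast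
    then have "z = cl_vec b * x" using b by (simp add: x Basis_square)
    then have "z \<in> I" using Cons.prems(1) by (simp add: two_sided_idealD[OF I])
    then have "z = 0" using Cons.IH yz bs by blast
    with y0 show ?case by (simp add: x)
  qed
  obtain bs :: "'e list" where "set bs = Basis" "distinct bs"
    using finite_distinct_list[OF finite_Basis] by blast
  then have "I \<subseteq> {0}"
    using ker[of bs] span_monomials_Basis[of bs] by auto
  then show ?thesis using two_sided_idealD(1)[OF I] by auto
qed


section \<open>Solving the quadratic Clifford equation modulo an ideal\<close>

text \<open>
  This is \<open>(L\<^sub>c - R\<^sub>d)\<^sup>2 x\<close>, written out.
\<close>

definition clifford_square :: "'e::euclidean_space clifford \<Rightarrow> 'e clifford \<Rightarrow> 'e clifford \<Rightarrow> 'e clifford"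
  where "clifford_square c d x = c * c * x - 2 *\<^sub>R (c * x * d) + x * d * d"

lemma quadratic_clifford_equation_iff:
  "quadratic_clifford_equation B c d \<longleftrightarrow> (\<forall>e. clifford_square c d (cl_vec e) = - cl_vec (B e))"
proof -
  have "((\<lambda>x. left_mult c x - right_mult d x) ^^ 2) x = clifford_square c d x" for x
    by (simp add: numeral_2_eq_2 left_mult_def right_mult_def clifford_square_def scaleR_2
        algebra_simps)
  moreover have "- cl_vec (B e) \<in> range cl_vec" for e
    by (metis linear_neg[OF linear_cl_vec] rangeI)
  ultimately show ?thesis
    by (auto simp: quadratic_clifford_equation_def Let_def)
qed

lemma clifford_square_cong:
  assumes I: "two_sided_ideal I" and "c - c' \<in> I" "d - d' \<in> I"
  shows "clifford_square c d x - clifford_square c' d' x \<in> I"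
proof -
  have "clifford_square c d x - clifford_square c' d' x =
      (c * ((c - c') * x) + (c - c') * (c' * x))
      - 2 *\<^sub>R ((c - c') * (x * d) + (c' * x) * (d - d'))
      + ((x * (d - d')) * d + (x * d') * (d - d'))"
    by (simp add: clifford_square_def algebra_simps)
  also have "\<dots> \<in> I"
    using assms(2,3) by (simp add: two_sided_idealD[OF I])
  finally show ?thesis .
qed

lemma parity_clifford_square:
  "parity (clifford_square c d x) = clifford_square (parity c) (parity d) (parity x)"
  by (simp add: clifford_square_def linear_add[OF parity(2)] linear_diff[OF parity(2)]
      linear_cmul[OF parity(2)] parity(4))

text \<open>
  In the application \<open>K\<close> is the kernel of \<open>\<rho>\<close>: a representation sees the quadratic equation only
  modulo \<open>K\<close>.  The intersection and the sum of \<open>K\<close> and \<open>\<alpha>(K)\<close> are graded ideals, so either \<open>K = 0\<close> or the algebra is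
  the product of its quotients by \<open>K\<close> and by \<open>\<alpha>(K)\<close>.  In the second case, as the equation is odd
  in \<open>e\<close> and \<open>\<alpha>\<close> exchanges the two quotients, \<open>(\<alpha>(c), \<alpha>(d))\<close> solves it modulo \<open>\<alpha>(K)\<close>; by the
  Chinese remainder theorem some pair is congruent to \<open>(c, d)\<close> modulo \<open>K\<close> and to
  \<open>(\<alpha>(c), \<alpha>(d))\<close> modulo \<open>\<alpha>(K)\<close>, and it is an exact solution.
\<close>

lemma quadratic_clifford_equation_lift:
  fixes K :: "'e::euclidean_space clifford set"
  assumes K: "two_sided_ideal K" and proper: "K \<noteq> UNIV"
    and sol: "\<And>e. clifford_square c d (cl_vec e) + cl_vec (B e) \<in> K"
  obtains c' d' where "c' - c \<in> K" "d' - d \<in> K" "quadratic_clifford_equation B c' d'"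
proof -
  define K' where "K' = parity ` K"
  have K'_iff: "x \<in> K' \<longleftrightarrow> parity x \<in> K" for x
    unfolding K'_def by (metis (no_types) image_iff parity_parity)
  have K': "two_sided_ideal K'"
    unfolding two_sided_ideal_def subspace_def Ball_def K'_iff
    by (simp add: linear_0[OF parity(2)] linear_add[OF parity(2)] linear_cmul[OF parity(2)]
        parity(4) two_sided_idealD[OF K])
  have "K \<inter> K' = {0} \<or> K \<inter> K' = UNIV"
  proof (rule graded_ideal_trivial)
    show "two_sided_ideal (K \<inter> K')"
      using K K' by (auto simp: two_sided_ideal_def subspace_inter)
    show "parity ` (K \<inter> K') \<subseteq> K \<inter> K'" by (auto simp: K'_iff)
  qed
  with proper have int: "K \<inter> K' = {0}" by auto
  define P where "P = {x + y | x y. x \<in> K \<and> y \<in> K'}"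
  have P: "P = {0} \<or> P = UNIV"
  proof (rule graded_ideal_trivial)
    have "subspace P"
      unfolding P_def using K K' by (intro subspace_sums) (auto simp: two_sided_ideal_def)
    then show "two_sided_ideal P"
      unfolding two_sided_ideal_def P_def
      using two_sided_idealD[OF K] two_sided_idealD[OF K']
      by (auto simp: distrib_left distrib_right) metis+
    show "parity ` P \<subseteq> P"
    proof (clarsimp simp: P_def)
      fix x y assume "x \<in> K" "y \<in> K'"
      then show "\<exists>x' y'. parity (x + y) = x' + y' \<and> x' \<in> K \<and> y' \<in> K'"
        by (intro exI[of _ "parity y"] exI[of _ "parity x"])
          (simp add: K'_iff linear_add[OF parity(2)])
    qed
  qed
  show ?thesis
  proof (cases "K = {0}")
    case True
    then have "quadratic_clifford_equation B c d"
      using sol by (simp add: quadratic_clifford_equation_iff eq_neg_iff_add_eq_0)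
    then show ?thesis using True that[of c d] by simp
  next
    case False
    then obtain x where "x \<in> K" "x \<noteq> 0" using two_sided_idealD(1)[OF K] by blast
    then have "x + 0 \<in> P" unfolding P_def using two_sided_idealD(1)[OF K'] by blast
    with \<open>x \<noteq> 0\<close> P have "1 \<in> P" by auto
    then obtain k k' where kk: "1 = k + k'" "k \<in> K" "k' \<in> K'"
      unfolding P_def by blast
    \<comment> \<open>Chinese remainder: \<open>k'\<close> is \<open>1\<close> modulo \<open>K\<close>, and \<open>k\<close> is \<open>1\<close> modulo \<open>\<alpha>(K)\<close>.\<close>
    define lift where "lift x = x * k' + parity x * k" for x
    have k: "k = 1 - k'" and k': "k' = 1 - k" using kk(1) by (simp_all add: algebra_simps)
    have "lift x - x = (parity x - x) * k" for x
      unfolding lift_def k' by (simp add: algebra_simps)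
    then have lift_K: "lift x - x \<in> K" for x
      using kk by (simp add: two_sided_idealD[OF K])
    have "lift x - parity x = (x - parity x) * k'" for x
      unfolding lift_def k by (simp add: algebra_simps)
    then have lift_K': "lift x - parity x \<in> K'" for x
      using kk by (simp add: two_sided_idealD[OF K'])
    have "clifford_square (lift c) (lift d) (cl_vec e) + cl_vec (B e) \<in> K \<inter> K'" for e
    proof
      show "clifford_square (lift c) (lift d) (cl_vec e) + cl_vec (B e) \<in> K"
        using two_sided_idealD(2)[OF K clifford_square_cong[OF K lift_K[of c] lift_K[of d], of "cl_vec e"] sol[of e]]
        by simp
      have "parity (clifford_square c d (cl_vec e) + cl_vec (B e)) \<in> K'"
        using sol by (simp add: K'_iff)
      also have "parity (clifford_square c d (cl_vec e) + cl_vec (B e))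
          = - (clifford_square (parity c) (parity d) (cl_vec e) + cl_vec (B e))"
        by (simp add: linear_add[OF parity(2)] parity_clifford_square parity(1))
          (simp add: clifford_square_def)
      finally have "clifford_square (parity c) (parity d) (cl_vec e) + cl_vec (B e) \<in> K'"
        using two_sided_idealD(4)[OF K'] by (metis minus_minus)
      then show "clifford_square (lift c) (lift d) (cl_vec e) + cl_vec (B e) \<in> K'"
        using two_sided_idealD(2)[OF K' clifford_square_cong[OF K' lift_K'[of c] lift_K'[of d], of "cl_vec e"]]
        by fastforce
    qed
    then have "quadratic_clifford_equation B (lift c) (lift d)"
      using int by (simp add: quadratic_clifford_equation_iff eq_neg_iff_add_eq_0)
    then show ?thesis using lift_K that by blast
  qed
qed


section \<open>Semi-spinors and admissible forms\<close>

context
  fixes \<rho> :: "'e::euclidean_space clifford \<Rightarrow> 's::real_vector \<Rightarrow> 's"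
  assumes irr: "irreducible_representation \<rho>"
begin

lemma rep_linear:
  shows "linear (\<rho> c)" and "linear (\<lambda>c. \<rho> c s)" and "\<rho> 1 s = s" and "\<rho> (c * d) s = \<rho> c (\<rho> d s)"
  using irr by (simp_all add: irreducible_representation_def clifford_representation_def)

lemma rep_simps:
  shows "\<rho> c (s + t) = \<rho> c s + \<rho> c t" "\<rho> c (s - t) = \<rho> c s - \<rho> c t" "\<rho> c (- s) = - \<rho> c s"
    "\<rho> c (a *\<^sub>R s) = a *\<^sub>R \<rho> c s" "\<rho> c 0 = 0"
    "\<rho> (c + d) s = \<rho> c s + \<rho> d s" "\<rho> (c - d) s = \<rho> c s - \<rho> d s" "\<rho> (- c) s = - \<rho> c s"
    "\<rho> (a *\<^sub>R c) s = a *\<^sub>R \<rho> c s" "\<rho> 0 s = 0" "\<rho> (c * d) s = \<rho> c (\<rho> d s)" "\<rho> 1 s = s"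
  using linear_add[OF rep_linear(1)] linear_diff[OF rep_linear(1)] linear_neg[OF rep_linear(1)]
    linear_cmul[OF rep_linear(1)] linear_0[OF rep_linear(1)]
    linear_add[OF rep_linear(2)] linear_diff[OF rep_linear(2)] linear_neg[OF rep_linear(2)]
    linear_cmul[OF rep_linear(2)] linear_0[OF rep_linear(2)]
  by (auto simp: rep_linear)

abbreviation (input) vec_op :: "'e \<Rightarrow> 's \<Rightarrow> 's"
  where "vec_op v \<equiv> \<rho> (cl_vec v)"

lemma vec_op_linear:
  shows "vec_op (v + w) s = vec_op v s + vec_op w s" "vec_op (a *\<^sub>R v) s = a *\<^sub>R vec_op v s"
    "vec_op 0 s = 0"
  by (simp_all add: linear_add[OF linear_cl_vec] linear_cmul[OF linear_cl_vec]
      linear_0[OF linear_cl_vec] rep_simps)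

lemma rep_of_real: "\<rho> (of_real a) s = a *\<^sub>R s"
  by (simp add: of_real_def rep_simps)

lemma vec_op_square: "vec_op v (vec_op v s) = (v \<bullet> v) *\<^sub>R s"
proof -
  have "vec_op v (vec_op v s) = \<rho> (cl_vec v * cl_vec v) s"
    by (simp only: rep_simps)
  then show ?thesis by (simp add: cl_vec_square ip_def rep_of_real)
qed

lemma vec_op_anticommute: "vec_op v (vec_op w s) + vec_op w (vec_op v s) = (2 * (v \<bullet> w)) *\<^sub>R s"
proof -
  have "vec_op v (vec_op w s) + vec_op w (vec_op v s) = \<rho> (cl_vec v * cl_vec w + cl_vec w * cl_vec v) s"
    by (simp only: rep_simps)
  then show ?thesis by (simp only: cl_vec_anticommute rep_of_real)
qed

lemma rep_nontrivial: "\<exists>s::'s. s \<noteq> 0"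
  using irr by (auto simp: irreducible_representation_def irreducible_submodule_def)

lemma rep_kernel_ideal: "two_sided_ideal (rep_kernel \<rho>)" "rep_kernel \<rho> \<noteq> UNIV"
proof -
  show "two_sided_ideal (rep_kernel \<rho>)"
    by (auto simp: two_sided_ideal_def subspace_def rep_kernel_def rep_simps fun_eq_iff)
  have "1 \<notin> rep_kernel \<rho>"
    using rep_nontrivial by (auto simp: rep_kernel_def rep_simps fun_eq_iff)
  then show "rep_kernel \<rho> \<noteq> UNIV" by auto
qed

lemma rep_kernel_diff: "c - d \<in> rep_kernel \<rho> \<longleftrightarrow> \<rho> c = \<rho> d"
  by (auto simp: rep_kernel_def rep_simps fun_eq_iff)

lemma vec_invariant_trivial:
  assumes W: "subspace W" and inv: "\<And>v s. s \<in> W \<Longrightarrow> vec_op v s \<in> W"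
  shows "W = {0} \<or> W = UNIV"
proof -
  have "\<forall>s\<in>W. \<rho> c s \<in> W" for c
    by (induction c rule: clifford_induct)
      (simp_all add: rep_of_real rep_simps inv subspace_add[OF W] subspace_scale[OF W])
  then have "invariant_subspace (range \<rho>) W"
    using W by (auto simp: invariant_subspace_def)
  then show ?thesis
    using irr by (auto simp: irreducible_representation_def irreducible_submodule_def)
qed

text \<open>
  The commutator \<open>[v,w]\<close> and \<open>2vw\<close> differ by a scalar, so the \<open>so(E)\<close>-submodules are the
  subspaces that are stable under the even Clifford algebra.
\<close>

lemma so_invariant_iff:
  "invariant_subspace (\<rho> ` so_clifford) W \<longleftrightarrow>
    subspace W \<and> (\<forall>v w. \<forall>s\<in>W. vec_op v (vec_op w s) \<in> W)"
proof (cases "subspace W")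
  case W: True
  show ?thesis
  proof
    assume inv: "invariant_subspace (\<rho> ` so_clifford) W"
    have "vec_op v (vec_op w s) \<in> W" if s: "s \<in> W" for v w s
    proof -
      define A where "A = (1/4) *\<^sub>R (cl_vec v * cl_vec w - cl_vec w * cl_vec v)"
      have "A \<in> so_clifford"
        unfolding A_def so_clifford_def by (rule span_base) blast
      then have "\<rho> A s \<in> W" using inv s by (auto simp: invariant_subspace_def)
      moreover have "vec_op v (vec_op w s) = 2 *\<^sub>R \<rho> A s + (v \<bullet> w) *\<^sub>R s"
      proof -
        have "2 *\<^sub>R vec_op v (vec_op w s) = 2 *\<^sub>R (2 *\<^sub>R \<rho> A s + (v \<bullet> w) *\<^sub>R s)"
          using vec_op_anticommute[of v w s]
          by (simp add: A_def rep_simps algebra_simps scaleR_2)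
        then show ?thesis by simp
      qed
      ultimately show ?thesis
        using s by (simp add: subspace_add[OF W] subspace_scale[OF W])
    qed
    then show "subspace W \<and> (\<forall>v w. \<forall>s\<in>W. vec_op v (vec_op w s) \<in> W)"
      using W by blast
  next
    assume inv: "subspace W \<and> (\<forall>v w. \<forall>s\<in>W. vec_op v (vec_op w s) \<in> W)"
    have "\<forall>s\<in>W. \<rho> A s \<in> W" if "A \<in> so_clifford" for A
      using that unfolding so_clifford_def
    proof (induction A rule: span_induct)
      case base
      show ?case
        by (auto simp: subspace_def rep_simps subspace_0[OF W] subspace_add[OF W] subspace_scale[OF W])
    next
      case (step A)
      then show ?case using inv
        by (auto simp: rep_simps intro!: subspace_diff[OF W] subspace_scale[OF W])
    qed
    then show "invariant_subspace (\<rho> ` so_clifford) W"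
      using W by (auto simp: invariant_subspace_def)
  qed
qed (simp add: invariant_subspace_def)

text \<open>
  Products of two vectors are moved past \<open>e\<close> with \<open>e\<^sup>2 = e \<bullet> e\<close>:
  \<open>v w e = e (e v) (w e) / (e \<bullet> e)\<close>, where \<open>e v\<close> and \<open>w e\<close> act within \<open>U\<close>.
\<close>

lemma vec_op_image_invariant:
  assumes "invariant_subspace (\<rho> ` so_clifford) U"
  shows "invariant_subspace (\<rho> ` so_clifford) (vec_op e ` U)"
  unfolding so_invariant_iff
proof (intro conjI allI ballI)
  have U: "subspace U" and inv: "\<And>v w s. s \<in> U \<Longrightarrow> vec_op v (vec_op w s) \<in> U"
    using assms by (auto simp: so_invariant_iff)
  show "subspace (vec_op e ` U)"
    using U by (rule linear_subspace_image[OF rep_linear(1)])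
  fix v w s assume "s \<in> vec_op e ` U"
  then obtain u where u: "u \<in> U" and s: "s = vec_op e u" by blast
  show "vec_op v (vec_op w s) \<in> vec_op e ` U"
  proof (cases "e = 0")
    case True
    then show ?thesis using u by (auto simp: s vec_op_linear rep_simps)
  next
    case False
    define u' where "u' = (1 / (e \<bullet> e)) *\<^sub>R vec_op e (vec_op v (vec_op w (vec_op e u)))"
    have "u' \<in> U" unfolding u'_def using u by (intro subspace_scale[OF U] inv)
    moreover have "vec_op e u' = vec_op v (vec_op w s)"
      using False by (simp add: u'_def s rep_simps vec_op_square)
    ultimately show ?thesis by force
  qed
qed

text \<open>
  Every vector \<open>v = e (e v)\<close> exchanges \<open>U\<close> and \<open>e U\<close>.  Their intersection and their sum are
  therefore Clifford submodules, and the irreducibility of the spinor module decides both.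
\<close>

lemma proper_so_invariant:
  assumes inv: "invariant_subspace (\<rho> ` so_clifford) U" and "U \<noteq> {0}" "U \<noteq> UNIV" and e: "e \<bullet> e = 1"
  shows "U \<inter> vec_op e ` U = {0}" and "{x + y | x y. x \<in> U \<and> y \<in> vec_op e ` U} = UNIV"
proof -
  have U: "subspace U" and UU: "\<And>v w s. s \<in> U \<Longrightarrow> vec_op v (vec_op w s) \<in> U"
    using inv by (auto simp: so_invariant_iff)
  have eU: "subspace (vec_op e ` U)"
    using U by (rule linear_subspace_image[OF rep_linear(1)])
  have ee: "vec_op e (vec_op e s) = s" for s
    by (simp add: vec_op_square e)
  have v_eU: "vec_op v s \<in> vec_op e ` U" if "s \<in> U" for v s
    using UU[OF that, of e v] by (metis ee image_eqI)
  have v_U: "vec_op v s \<in> U" if "s \<in> vec_op e ` U" for v s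
    using that UU by auto
  have "U \<inter> vec_op e ` U = {0} \<or> U \<inter> vec_op e ` U = UNIV"
    by (rule vec_invariant_trivial) (auto simp: subspace_inter U eU v_U intro: v_eU)
  then show "U \<inter> vec_op e ` U = {0}" using \<open>U \<noteq> UNIV\<close> by auto
  define P where "P = {x + y | x y. x \<in> U \<and> y \<in> vec_op e ` U}"
  have "P = {0} \<or> P = UNIV"
  proof (rule vec_invariant_trivial)
    show "subspace P" unfolding P_def using U eU by (rule subspace_sums)
    fix v s assume "s \<in> P"
    then obtain x y where "s = x + y" "x \<in> U" "y \<in> vec_op e ` U" unfolding P_def by blast
    then have "vec_op v s = vec_op v y + vec_op v x" "vec_op v y \<in> U" "vec_op v x \<in> vec_op e ` U"
      using v_eU v_U by (auto simp: rep_simps add.commute)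
    then show "vec_op v s \<in> P" unfolding P_def by blast
  qed
  moreover have "U \<subseteq> P"
    using subspace_0[OF eU] unfolding P_def by force
  ultimately show "P = UNIV"
    using \<open>U \<noteq> {0}\<close> subspace_0[OF U] by blast
qed

lemma unit_vector: obtains e :: 'e where "e \<bullet> e = 1"
  using SOME_Basis inner_Basis by (metis (full_types))

text \<open>
  A nonzero submodule \<open>V\<close> of \<open>U\<close> satisfies \<open>V + e V = UNIV\<close>, while \<open>e V\<close>, being part of
  \<open>e U\<close>, meets \<open>U\<close> only in zero; so \<open>V\<close> is all of \<open>U\<close>.
\<close>

lemma proper_so_invariant_irreducible:
  assumes inv: "invariant_subspace (\<rho> ` so_clifford) U" and U: "U \<noteq> {0}" "U \<noteq> UNIV"
  shows "irreducible_submodule (\<rho> ` so_clifford) U"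
  unfolding irreducible_submodule_def
proof (intro conjI allI impI inv U)
  fix V assume V: "invariant_subspace (\<rho> ` so_clifford) V" and VU: "V \<subseteq> U"
  obtain e :: 'e where e: "e \<bullet> e = 1" by (rule unit_vector)
  have "U \<subseteq> V" if V0: "V \<noteq> {0}"
  proof
    fix u assume u: "u \<in> U"
    have "V \<noteq> UNIV" using VU U by auto
    then obtain x y where xy: "u = x + vec_op e y" "x \<in> V" "y \<in> V"
      using proper_so_invariant(2)[OF V V0 _ e] by blast
    have "subspace U" using inv by (simp add: invariant_subspace_def)
    then have "u - x \<in> U" using u xy VU by (blast intro: subspace_diff)
    with xy VU have "vec_op e y \<in> U \<inter> vec_op e ` U" by auto
    then have "vec_op e y = 0" using proper_so_invariant(1)[OF inv U e] by auto
    then show "u \<in> V" using xy by simp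
  qed
  with VU show "V = {0} \<or> V = U" by blast
qed

text \<open>
  Any nonzero spinor generates the module, which is therefore a quotient of the Clifford algebra.
\<close>

lemma spinors_finite_dimensional:
  obtains F :: "'s set" where "finite F" "span F = UNIV"
proof -
  obtain M :: "'e clifford set" where M: "finite M" "span M = UNIV"
    by (rule clifford_finite_dimensional)
  obtain s :: 's where "s \<noteq> 0" using rep_nontrivial by blast
  define F where "F = (\<lambda>c. \<rho> c s) ` M"
  have F: "span F = range (\<lambda>c. \<rho> c s)"
    unfolding F_def linear_span_image[OF rep_linear(2)] M(2) ..
  have "span F = {0} \<or> span F = UNIV"
  proof (rule vec_invariant_trivial)
    fix v t assume "t \<in> span F"
    then obtain c where "t = \<rho> c s" unfolding F by blast
    then have "vec_op v t = \<rho> (cl_vec v * c) s" by (simp add: rep_simps)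
    then show "vec_op v t \<in> span F" unfolding F by blast
  qed simp
  moreover have "s \<in> span F" unfolding F using rep_simps(12) by (metis rangeI)
  ultimately have "span F = UNIV" using \<open>s \<noteq> 0\<close> by auto
  moreover have "finite F" using M by (simp add: F_def)
  ultimately show ?thesis using that by blast
qed

text \<open>
  Dimension count: for a basis \<open>C\<close> of \<open>W\<close>, the map \<open>s \<mapsto> \<Sum>c\<in>C. \<Gamma>(s,c) c\<close> has its values in \<open>W\<close> and
  vanishes precisely at the \<open>s\<close> that are orthogonal to \<open>W\<close>; it cannot be injective, as \<open>W\<close> is a
  proper subspace of a finite dimensional space.
\<close>

lemma orthogonal_vector_exists:
  fixes \<Gamma> :: "'s \<Rightarrow> 's \<Rightarrow> real"
  assumes \<Gamma>: "bilinear \<Gamma>" and W: "subspace W" "W \<noteq> UNIV"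
  obtains s where "s \<noteq> 0" "\<forall>w\<in>W. \<Gamma> s w = 0"
proof -
  obtain C where C: "C \<subseteq> W" "independent C" "W \<subseteq> span C"
    using basis_exists by metis
  obtain F :: "'s set" where F: "finite F" "span F = UNIV" by (rule spinors_finite_dimensional)
  have fin: "finite C" using independent_span_bound[OF F(1) C(2)] F(2) by simp
  have spC: "span C = W" using C W by (metis span_minimal subset_antisym)
  obtain s0 where s0: "s0 \<notin> W" using W by blast
  then have ind: "independent (insert s0 C)" "s0 \<notin> C"
    using C by (auto simp: independent_insert spC)
  define L where "L s = (\<Sum>c\<in>C. \<Gamma> s c *\<^sub>R c)" for s
  have linL: "linear L"
    unfolding L_def
    by (rule linearI) (simp_all add: bilinear_ladd[OF \<Gamma>] bilinear_lmul[OF \<Gamma>] scaleR_add_left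
        sum.distrib scaleR_sum_right)
  have LW: "L s \<in> span C" for s
    unfolding L_def by (intro span_sum span_scale span_base)
  have "\<not> inj L"
  proof
    assume inj: "inj L"
    then have "independent (L ` insert s0 C)"
      by (intro linear_independent_injective_image[OF linL ind(1)]) (rule inj_on_subset[OF _ subset_UNIV])
    then have "card (L ` insert s0 C) \<le> card C"
      using independent_span_bound[OF fin] LW by blast
    moreover have "card (L ` insert s0 C) = card (insert s0 C)"
      using inj by (intro card_image) (rule inj_on_subset[OF _ subset_UNIV])
    ultimately show False using ind(2) fin by simp
  qed
  then obtain s where s: "s \<noteq> 0" "L s = 0"
    using linear_injective_0[OF linL] by blast
  have C0: "\<Gamma> s c = 0" if "c \<in> C" for c
    using s(2) independentD[OF C(2) fin order_refl _ that, of "\<Gamma> s"] unfolding L_def by blast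
  have "linear (\<Gamma> s)" using \<Gamma> by (simp add: bilinear_def)
  then have "\<Gamma> s w = 0" if "w \<in> W" for w
    using linear_eq_0_on_span[of "\<Gamma> s" C] C0 that spC by blast
  with s that show ?thesis by blast
qed

text \<open>
  The choice of the semi-spinors depends on \<open>\<Gamma>\<close>.  If all proper submodules are isotropic, then
  \<open>U\<close> and \<open>e U\<close> will do for any of them.  Otherwise some irreducible \<open>W\<close> is not isotropic; the
  radical of \<open>\<Gamma>\<close> on \<open>W\<close> is a submodule, hence zero, so \<open>W\<close> meets its orthogonal complement only in
  zero.  The complement is nonzero by dimension, and as every proper submodule is irreducible, the
  two together span everything.
\<close>

lemma semi_spinor_splitting:
  fixes \<Gamma> :: "'s \<Rightarrow> 's \<Rightarrow> real"
  assumes \<Gamma>: "bilinear \<Gamma>"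
    and \<tau>: "\<And>e s t. \<Gamma> (vec_op e s) t = \<tau> * \<Gamma> s (vec_op e t)" "\<tau> * \<tau> = 1"
    and \<sigma>: "\<And>s t. \<Gamma> s t = \<sigma> * \<Gamma> t s"
    and red: "\<not> irreducible_submodule (\<rho> ` so_clifford) UNIV"
  shows "\<exists>Sp Sm. irreducible_submodule (\<rho> ` so_clifford) Sp \<and>
        irreducible_submodule (\<rho> ` so_clifford) Sm \<and>
        Sp \<inter> Sm = {0} \<and> {x + y | x y. x \<in> Sp \<and> y \<in> Sm} = UNIV \<and>
        ((\<forall>x\<in>Sp. \<forall>y\<in>Sm. \<Gamma> x y = 0 \<and> \<Gamma> y x = 0) \<or>
         (\<forall>x\<in>Sp. \<forall>y\<in>Sp. \<Gamma> x y = 0) \<and> (\<forall>x\<in>Sm. \<forall>y\<in>Sm. \<Gamma> x y = 0))"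
proof -
  let ?inv = "invariant_subspace (\<rho> ` so_clifford)"
  obtain e :: 'e where e: "e \<bullet> e = 1" by (rule unit_vector)
  have "?inv UNIV" by (simp add: so_invariant_iff)
  moreover have "(UNIV :: 's set) \<noteq> {0}" using rep_nontrivial by auto
  ultimately obtain U where U: "?inv U" "U \<noteq> {0}" "U \<noteq> UNIV"
    using red unfolding irreducible_submodule_def by blast
  show ?thesis
  proof (cases "\<exists>W. ?inv W \<and> W \<noteq> {0} \<and> W \<noteq> UNIV \<and> (\<exists>x\<in>W. \<exists>y\<in>W. \<Gamma> x y \<noteq> 0)")
    case True
    then obtain W where W: "?inv W" "W \<noteq> {0}" "W \<noteq> UNIV" "\<exists>x\<in>W. \<exists>y\<in>W. \<Gamma> x y \<noteq> 0" by blast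
    note irrW = proper_so_invariant_irreducible[OF W(1,2,3)]
    have sW: "subspace W" using W by (simp add: invariant_subspace_def)
    define V where "V = {s. \<forall>w\<in>W. \<Gamma> s w = 0}"
    have "?inv V"
      unfolding so_invariant_iff
    proof (intro conjI allI ballI)
      show "subspace V"
        by (auto simp: subspace_def V_def bilinear_lzero[OF \<Gamma>] bilinear_ladd[OF \<Gamma>] bilinear_lmul[OF \<Gamma>])
      fix v w s assume "s \<in> V"
      then show "vec_op v (vec_op w s) \<in> V"
        using W(1) by (simp add: V_def \<tau>(1) so_invariant_iff)
    qed
    obtain s where s: "s \<noteq> 0" "\<forall>w\<in>W. \<Gamma> s w = 0"
      by (rule orthogonal_vector_exists[OF \<Gamma> sW W(3)])
    then have "s \<in> V" by (simp add: V_def)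
    with s(1) have "V \<noteq> {0}" by auto
    have "?inv (W \<inter> V)"
      using W(1) \<open>?inv V\<close> by (auto simp: so_invariant_iff subspace_inter)
    then have "W \<inter> V = {0} \<or> W \<inter> V = W"
      using irrW unfolding irreducible_submodule_def by blast
    moreover have "W \<inter> V \<noteq> W" using W(4) unfolding V_def by blast
    ultimately have int: "W \<inter> V = {0}" by blast
    then have "V \<noteq> UNIV" using W(2) by auto
    define P where "P = {x + y | x y. x \<in> W \<and> y \<in> V}"
    have sV: "subspace V" using \<open>?inv V\<close> by (simp add: invariant_subspace_def)
    have WP: "W \<subseteq> P" and VP: "V \<subseteq> P"
      unfolding P_def using subspace_0[OF sV] subspace_0[OF sW] by force+
    have "?inv P"
      unfolding so_invariant_iff
    proof (intro conjI allI ballI)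
      show "subspace P" unfolding P_def using sW sV by (rule subspace_sums)
      fix v w s assume "s \<in> P"
      then show "vec_op v (vec_op w s) \<in> P"
        using W(1) \<open>?inv V\<close> unfolding P_def so_invariant_iff by (auto simp: rep_simps) blast
    qed
    have "P = UNIV"
    proof (rule ccontr)
      assume "P \<noteq> UNIV"
      moreover have "P \<noteq> {0}" using WP W(2) subspace_0[OF sW] by blast
      ultimately have "W = P"
        using proper_so_invariant_irreducible[OF \<open>?inv P\<close>] W(1,2) WP
        unfolding irreducible_submodule_def by blast
      with VP int \<open>V \<noteq> {0}\<close> subspace_0[OF sV] show False by blast
    qed
    moreover have "\<forall>x\<in>W. \<forall>y\<in>V. \<Gamma> x y = 0 \<and> \<Gamma> y x = 0"
    proof (intro ballI conjI)
      fix x y assume "x \<in> W" "y \<in> V"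
      then show "\<Gamma> y x = 0" by (simp add: V_def)
      then show "\<Gamma> x y = 0" by (subst \<sigma>) simp
    qed
    ultimately show ?thesis
      using irrW proper_so_invariant_irreducible[OF \<open>?inv V\<close> \<open>V \<noteq> {0}\<close> \<open>V \<noteq> UNIV\<close>] int
      unfolding P_def by blast
  next
    case False
    define V where "V = vec_op e ` U"
    note split = proper_so_invariant[OF U e, folded V_def]
    have invV: "?inv V" unfolding V_def using U(1) by (rule vec_op_image_invariant)
    have "V \<noteq> UNIV" using split(1) U(2) by auto
    moreover have "V \<noteq> {0}" using split(2) U(3) by auto
    ultimately show ?thesis
      using False U invV split proper_so_invariant_irreducible[OF U]
        proper_so_invariant_irreducible[OF invV] by blast
  qed
qed

text \<open>
  The condition on the right is what the superalgebra axioms yield for the form on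
  \<open>S\<^sub>- \<times> S\<^sub>+\<close>.  It is inherited by the transposed form, hence by the symmetric and the skew part,
  and a form of symmetry \<open>\<sigma>\<close> that satisfies it has type \<open>\<tau> = - \<sigma>\<close>.  So \<open>\<beta>\<close> is the sum of
  two admissible forms.
\<close>

lemma bil_minus_iff:
  "\<beta> \<in> bil_minus \<rho> \<longleftrightarrow> bilinear \<beta> \<and> (\<forall>e s t. \<beta> (vec_op e s) t = - \<beta> (vec_op e t) s)"
proof
  assume "\<beta> \<in> bil_minus \<rho>"
  then obtain F a where F: "finite F" and \<beta>: "\<beta> = (\<lambda>s t. \<Sum>\<Gamma>\<in>F. a \<Gamma> * \<Gamma> s t)"
    and adm: "\<And>\<Gamma>. \<Gamma> \<in> F \<Longrightarrow> \<exists>\<tau> \<sigma>. admissible_form \<rho> \<tau> \<sigma> \<Gamma> \<and> \<tau> * \<sigma> = -1"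
    unfolding bil_minus_def by blast
  have bil: "bilinear \<Gamma>" if "\<Gamma> \<in> F" for \<Gamma>
    using adm[OF that] by (auto simp: admissible_form_def)
  have skew: "\<Gamma> (vec_op e s) t = - \<Gamma> (vec_op e t) s" if mem: "\<Gamma> \<in> F" for \<Gamma> e s t
  proof -
    obtain \<tau> \<sigma> where ts: "\<tau> * \<sigma> = -1" and "admissible_form \<rho> \<tau> \<sigma> \<Gamma>"
      using adm[OF mem] by blast
    then have "\<forall>e s t. \<Gamma> (vec_op e s) t = \<tau> * \<Gamma> s (vec_op e t)" "\<forall>s t. \<Gamma> s t = \<sigma> * \<Gamma> t s"
      unfolding admissible_form_def by - (elim conjE, assumption)+
    then have "\<Gamma> (vec_op e s) t = \<tau> * (\<sigma> * \<Gamma> (vec_op e t) s)" by metis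
    then show ?thesis by (simp add: ts flip: mult.assoc)
  qed
  show "bilinear \<beta> \<and> (\<forall>e s t. \<beta> (vec_op e s) t = - \<beta> (vec_op e t) s)"
  proof (intro conjI allI)
    show "bilinear \<beta>"
      unfolding bilinear_def \<beta>
      by (auto intro!: linearI simp: bilinear_ladd[OF bil] bilinear_radd[OF bil] bilinear_lmul[OF bil]
          bilinear_rmul[OF bil] distrib_left sum.distrib sum_distrib_left mult_ac cong: sum.cong)
    show "\<beta> (vec_op e s) t = - \<beta> (vec_op e t) s" for e s t
      unfolding \<beta> sum_negf[symmetric]
      by (rule sum.cong[OF refl]) (subst skew, simp_all)
  qed
next
  assume "bilinear \<beta> \<and> (\<forall>e s t. \<beta> (vec_op e s) t = - \<beta> (vec_op e t) s)"
  then have \<beta>: "bilinear \<beta>" and skew: "\<And>e s t. \<beta> (vec_op e s) t = - \<beta> (vec_op e t) s"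
    by blast+
  \<comment> \<open>The transposed form satisfies the identity as well: apply \<open>skew\<close> to \<open>e s\<close> and \<open>e t\<close> in place of \<open>s\<close> and \<open>t\<close>.\<close>
  have skew': "\<beta> s (vec_op e t) = - \<beta> t (vec_op e s)" for e s t
  proof (cases "e = 0")
    case True
    then show ?thesis by (simp add: vec_op_linear bilinear_rzero[OF \<beta>])
  next
    case False
    have "(e \<bullet> e) * \<beta> s (vec_op e t) = \<beta> (vec_op e (vec_op e s)) (vec_op e t)"
      by (simp add: vec_op_square bilinear_lmul[OF \<beta>])
    also have "\<dots> = - \<beta> (vec_op e (vec_op e t)) (vec_op e s)" by (rule skew)
    also have "\<dots> = (e \<bullet> e) * - \<beta> t (vec_op e s)"
      by (simp add: vec_op_square bilinear_lmul[OF \<beta>])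
    finally show ?thesis using False by (metis inner_eq_zero_iff mult_left_cancel)
  qed
  define part where "part \<sigma> s t = (\<beta> s t + \<sigma> * \<beta> t s) / 2" for \<sigma> s t
  have part: "admissible_form \<rho> (- \<sigma>) \<sigma> (part \<sigma>)" if \<sigma>: "\<sigma> \<in> {1, -1}" for \<sigma>
  proof -
    have bil: "bilinear (part \<sigma>)"
      unfolding bilinear_def part_def
      by (auto intro!: linearI simp: bilinear_ladd[OF \<beta>] bilinear_radd[OF \<beta>]
          bilinear_lmul[OF \<beta>] bilinear_rmul[OF \<beta>] field_simps)
    have sym: "part \<sigma> s t = \<sigma> * part \<sigma> t s" for s t
      using \<sigma> by (auto simp: part_def field_simps)
    have ty: "part \<sigma> (vec_op e s) t = - \<sigma> * part \<sigma> s (vec_op e t)" for e s t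
      using \<sigma> skew[of e s t] skew'[of s e t] by (auto simp: part_def field_simps)
    have so: "part \<sigma> (\<rho> A s) t + part \<sigma> s (\<rho> A t) = 0" if "A \<in> so_clifford" for A s t
      using that unfolding so_clifford_def
    proof (induction A rule: span_induct)
      case base
      show ?case
        by (auto simp: subspace_def rep_simps bilinear_ladd[OF bil] bilinear_radd[OF bil]
            bilinear_lmul[OF bil] bilinear_rmul[OF bil] bilinear_lzero[OF bil] bilinear_rzero[OF bil]
            simp flip: distrib_left)
    next
      case (step A)
      have "\<sigma> * \<sigma> = 1" using \<sigma> by auto
      then have "part \<sigma> (vec_op v (vec_op w s)) t = part \<sigma> s (vec_op w (vec_op v t))" for v w
        by (simp add: ty)
      with step show ?case
        by (auto simp: rep_simps bilinear_lsub[OF bil] bilinear_rsub[OF bil]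
            bilinear_lmul[OF bil] bilinear_rmul[OF bil] diff_divide_distrib)
    qed
    have sq: "- \<sigma> * - \<sigma> = 1" using \<sigma> by auto
    have neg: "- \<sigma> \<in> {1, -1}" using \<sigma> by auto
    note split = semi_spinor_splitting[OF bil ty sq sym]
    show ?thesis
      unfolding admissible_form_def
      by (intro conjI allI ballI impI bil so ty sym \<sigma> neg split)
  qed
  \<comment> \<open>The two parts coincide only if both vanish; the coefficient \<open>2\<close> then covers the repeated summand.\<close>
  define a where "a \<Gamma> = (if part 1 = part (-1) then 2 else 1 :: real)" for \<Gamma> :: "'s \<Rightarrow> 's \<Rightarrow> real"
  have "\<beta> = (\<lambda>s t. \<Sum>\<Gamma>\<in>{part 1, part (-1)}. a \<Gamma> * \<Gamma> s t)"
  proof (intro ext)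
    fix s t
    have "\<beta> s t = part 1 s t + part (-1) s t" by (simp add: part_def field_simps)
    then show "\<beta> s t = (\<Sum>\<Gamma>\<in>{part 1, part (-1)}. a \<Gamma> * \<Gamma> s t)"
      by (cases "part 1 = part (-1)") (auto simp: a_def)
  qed
  moreover have "\<forall>\<Gamma>\<in>{part 1, part (-1)}. \<exists>\<tau> \<sigma>. admissible_form \<rho> \<tau> \<sigma> \<Gamma> \<and> \<tau> * \<sigma> = -1"
    using part[of 1] part[of "-1"] by auto (metis mult_1 mult.right_neutral)+
  ultimately show "\<beta> \<in> bil_minus \<rho>"
    unfolding bil_minus_def by blast
qed

end


section \<open>Zero charge spin representations\<close>

lemma block_apply [simp]: "block f g h k (s, t) = (f s + g t, h s + k t)"
  by (simp add: block_def)

lemma cw_operator: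
  assumes b: "nondegenerate_symmetric_form b" and B: "\<And>e f. b e f = - \<langle>B e,f\<rangle>"
  shows "linear B" and "surj B"
proof -
  have bil: "bilinear b" using b by (simp add: nondegenerate_symmetric_form_def)
  have inner: "B e \<bullet> f = b e f" for e f by (simp add: B ip_def)
  show lin: "linear B"
    by (rule linearI; rule vector_eq_rdot[THEN iffD1])
      (simp_all add: inner inner_add_left bilinear_ladd[OF bil] bilinear_lmul[OF bil])
  have "e = 0" if "B e = 0" for e
    using b that by (simp add: nondegenerate_symmetric_form_def flip: inner)
  then have "inj B" by (simp add: linear_injective_0[OF lin])
  then show "surj B" using linear_injective_imp_surjective[OF lin] by simp
qed

lemma linear_flat: "linear (flat :: 'e::euclidean_space \<Rightarrow> _)"
  by standard (auto intro!: blinfun_eqI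
      simp: flat_apply ip_def inner_add_left blinfun.add_left blinfun.scaleR_left)

lemma linear_sharp: "linear (sharp :: _ \<Rightarrow> 'e::euclidean_space)"
proof
  show "sharp (\<phi> + \<psi>) = sharp \<phi> + sharp \<psi>" for \<phi> \<psi> :: "'e \<Rightarrow>\<^sub>L real"
    by (metis linear_add[OF linear_flat] sharp_flat)
  show "sharp (a *\<^sub>R \<phi>) = a *\<^sub>R sharp \<phi>" for a and \<phi> :: "'e \<Rightarrow>\<^sub>L real"
    by (metis linear_cmul[OF linear_flat] sharp_flat)
qed

lemma flat_inject: "flat e = flat f \<longleftrightarrow> e = f"
  by (metis sharp_flat(1))

lemma cw_decompose:
  "(\<phi>, e, x, y) = cw_dual (flat (sharp \<phi>)) + cw_vec e + x *\<^sub>R cw_p + y *\<^sub>R cw_q"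
  by (simp add: cw_dual_def cw_vec_def cw_p_def cw_q_def)

lemma cw_jacobi:
  assumes b: "nondegenerate_symmetric_form b" and B: "\<And>e f. b e f = - \<langle>B e,f\<rangle>"
  shows "cw_bracket b B X (cw_bracket b B Y Z)
    = cw_bracket b B (cw_bracket b B X Y) Z + cw_bracket b B Y (cw_bracket b B X Z)"
proof -
  have bil: "bilinear b" and sym: "\<And>e f. b e f = b f e"
    using b by (auto simp: nondegenerate_symmetric_form_def)
  have bB: "b e (B f) = b f (B e)" for e f
    by (simp add: B ip_def inner_commute)
  note lins = linear_add[OF cw_operator(1)[OF b B]] linear_diff[OF cw_operator(1)[OF b B]]
    linear_cmul[OF cw_operator(1)[OF b B]] linear_0[OF cw_operator(1)[OF b B]]
    linear_diff[OF linear_flat] linear_cmul[OF linear_flat]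
    linear_diff[OF linear_sharp] linear_cmul[OF linear_sharp]
    bilinear_ladd[OF bil] bilinear_radd[OF bil] bilinear_lmul[OF bil] bilinear_rmul[OF bil]
    bilinear_lsub[OF bil] bilinear_rsub[OF bil]
  obtain \<phi> e x y where X: "X = (\<phi>, e, x, y)" by (cases X) auto
  obtain \<phi>' e' x' y' where Y: "Y = (\<phi>', e', x', y')" by (cases Y) auto
  obtain \<phi>'' e'' x'' y'' where Z: "Z = (\<phi>'', e'', x'', y'')" by (cases Z) auto
  show ?thesis
    using sym[of e e'] sym[of e e''] sym[of e' e'']
      bB[of "sharp \<phi>" "sharp \<phi>'"] bB[of "sharp \<phi>" "sharp \<phi>''"] bB[of "sharp \<phi>'" "sharp \<phi>''"]
    by (simp add: X Y Z cw_bracket_def lins algebra_simps)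
qed

text \<open>
  The linear extension of the operators in the theorem; collecting each entry of the block
  matrix into one Clifford element makes it visible that \<open>m\<close> acts through \<open>Cl(m)\<close>.
\<close>

definition cw_rep ::
    "('e::euclidean_space clifford \<Rightarrow> 's::real_vector \<Rightarrow> 's) \<Rightarrow> ('e \<Rightarrow> 'e) \<Rightarrow>
     'e clifford \<Rightarrow> 'e clifford \<Rightarrow> 'e clifford \<Rightarrow> 'e cw \<Rightarrow> 's \<times> 's \<Rightarrow> 's \<times> 's"
  where "cw_rep \<rho> B c1 c2 c3 = (\<lambda>(\<phi>, e, x, y).
    block (\<rho> (y *\<^sub>R c1))
      (\<rho> (sqrt 2 *\<^sub>R (cl_vec (B (sharp \<phi>)) + cl_vec e * c2 - c1 * cl_vec e) + y *\<^sub>R c3))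
      (\<lambda>s. 0) (\<rho> (y *\<^sub>R c2)))"

context
  fixes \<rho> :: "'e::euclidean_space clifford \<Rightarrow> 's::real_vector \<Rightarrow> 's"
  assumes irr: "irreducible_representation \<rho>"
begin

lemmas rep = rep_simps[OF irr]

lemma quadratic_clifford_equation_rep:
  assumes "quadratic_clifford_equation B c d"
  shows "\<rho> c (\<rho> c (\<rho> (cl_vec e) s)) - 2 *\<^sub>R \<rho> c (\<rho> (cl_vec e) (\<rho> d s)) + \<rho> (cl_vec e) (\<rho> d (\<rho> d s))
    = - \<rho> (cl_vec (B e)) s"
proof -
  have "\<rho> (clifford_square c d (cl_vec e)) s = \<rho> (- cl_vec (B e)) s"
    using assms by (simp add: quadratic_clifford_equation_iff)
  then show ?thesis by (simp add: clifford_square_def rep)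
qed

text \<open>
  All four entries lie in \<open>\<rho>(Cl)\<close>, as the parity automorphism on two of the coefficients does
  not lead out of it.
\<close>

lemma rho_spin_range:
  assumes "f \<in> range (rho_spin \<rho>)"
  obtains c d c' d' where "f = block (\<rho> c) (\<rho> d) (\<rho> d') (\<rho> c')"
proof -
  from assms obtain c0 cp cq cpq where "f = rho_spin \<rho> (c0, cp, cq, cpq)" by auto
  then have "f = block (\<rho> (parity c0 - 2 *\<^sub>R parity cpq)) (\<rho> ((2 * sqrt 2) *\<^sub>R cp))
      (\<rho> (- (1 / sqrt 2) *\<^sub>R parity cq)) (\<rho> c0)"
    by (auto simp: rho_spin_def rep fun_eq_iff)
  then show ?thesis by (rule that)
qed

lemma rho_spin_range_upper: "block (\<rho> c) (\<rho> d) (\<lambda>s. 0) (\<rho> c') \<in> range (rho_spin \<rho>)"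
proof -
  have "block (\<rho> c) (\<rho> d) (\<lambda>s. 0) (\<rho> c')
      = rho_spin \<rho> (c', (1 / (2 * sqrt 2)) *\<^sub>R d, 0, (1/2) *\<^sub>R (c' - parity c))"
    by (auto simp: rho_spin_def rep fun_eq_iff linear_diff[OF parity(2)] linear_cmul[OF parity(2)]
        linear_0[OF parity(2)])
  then show ?thesis by (metis rangeI)
qed

text \<open>
  The operators of \<open>e\<^sup>\<flat>\<close> are prescribed, and that of \<open>q\<close> determines the rest.  As \<open>B\<close> is onto,
  \<open>[e\<^sup>\<flat>, q] = B e\<close> gives the operators of \<open>E\<close>; applied to \<open>[e'\<^sup>\<flat>, e] = b(e',e) p\<close> with \<open>B e' = e\<close>
  this yields \<open>e d e = 0\<close> for the lower left entry \<open>d\<close> of \<open>q\<close>, so \<open>d = 0\<close>; and then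
  \<open>[q, e] = e\<^sup>\<flat>\<close> is the quadratic equation modulo the kernel of \<open>\<rho>\<close>.
\<close>

lemma zero_charge_representation_form:
  assumes b: "nondegenerate_symmetric_form b" and B: "\<And>e f. b e f = - \<langle>B e,f\<rangle>"
    and R: "zero_charge_spin_representation \<rho> b B R"
  obtains c1 c2 c3 where "quadratic_clifford_equation B c1 c2"
    "R cw_q = block (\<rho> c1) (\<rho> c3) (\<lambda>s. 0) (\<rho> c2)"
    "\<And>e. R (cw_vec e) = block (\<lambda>s. 0)
      (\<lambda>s. sqrt 2 *\<^sub>R (\<rho> (cl_vec e) (\<rho> c2 s) - \<rho> c1 (\<rho> (cl_vec e) s))) (\<lambda>s. 0) (\<lambda>s. 0)"
proof -
  have lie: "lie_representation (cw_bracket b B) R"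
    and flat: "\<And>e. R (cw_dual (flat e)) =
      block (\<lambda>s. 0) (\<lambda>s. sqrt 2 *\<^sub>R \<rho> (cl_vec (B e)) s) (\<lambda>s. 0) (\<lambda>s. 0)"
    and p0: "R cw_p = (\<lambda>Q. 0)" and cl: "R ` cw_m \<subseteq> range (rho_spin \<rho>)"
    using R by (auto simp: zero_charge_spin_representation_def spin_representation_def)
  have br: "R (cw_bracket b B X Y) Q = R X (R Y Q) - R Y (R X Q)" for X Y Q
    using lie unfolding lie_representation_def by blast
  have linR: "linear (\<lambda>X. R X Q)" for Q
    using lie unfolding lie_representation_def by blast
  have "cw_q \<in> (cw_m :: 'e cw set)" by (simp add: cw_q_def cw_m_def)
  with cl have "R cw_q \<in> range (rho_spin \<rho>)" by blast
  then obtain a c d f where q: "R cw_q = block (\<rho> a) (\<rho> c) (\<rho> d) (\<rho> f)"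
    by (rule rho_spin_range)
  have vecB: "R (cw_vec (B e)) (s, t) =
      (sqrt 2 *\<^sub>R (\<rho> (cl_vec (B e)) (\<rho> d s) + \<rho> (cl_vec (B e)) (\<rho> f t) - \<rho> a (\<rho> (cl_vec (B e)) t)),
       - (sqrt 2 *\<^sub>R \<rho> d (\<rho> (cl_vec (B e)) t)))" for e s t
    using br[of "cw_dual (flat e)" cw_q "(s, t)"]
    by (simp add: cw_brackets(3)[OF b B] flat q rep algebra_simps)
  have surj: "\<exists>f. e = B f" for e using cw_operator(2)[OF b B] by (metis surjD)
  have vec: "R (cw_vec e) (s, t) =
      (sqrt 2 *\<^sub>R (\<rho> (cl_vec e) (\<rho> d s) + \<rho> (cl_vec e) (\<rho> f t) - \<rho> a (\<rho> (cl_vec e) t)),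
       - (sqrt 2 *\<^sub>R \<rho> d (\<rho> (cl_vec e) t)))" for e s t
    using vecB surj[of e] by metis
  have d0: "\<rho> d = (\<lambda>s. 0)"
  proof
    fix s
    obtain e :: 'e where e: "e \<bullet> e = 1" by (rule unit_vector[OF irr])
    have ee: "\<rho> (cl_vec e) (\<rho> (cl_vec e) t) = t" for t
      by (simp add: vec_op_square[OF irr] e)
    obtain e' where e': "e = B e'" using surj by blast
    define t where "t = \<rho> (cl_vec e) s"
    have "0 = fst (R (b e' e *\<^sub>R cw_p) (0, t))"
      using p0 linear_cmul[of "\<lambda>X. R X (0, t)" "b e' e" cw_p] linR by simp
    also have "\<dots> = - 4 *\<^sub>R \<rho> (cl_vec e) (\<rho> d (\<rho> (cl_vec e) t))"
      using br[of "cw_dual (flat e')" "cw_vec e" "(0, t)"]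
        scaleR_left_distrib[of 2 2 "\<rho> (cl_vec e) (\<rho> d (\<rho> (cl_vec e) t))"]
      by (simp add: cw_brackets(2)[OF b B] flat vec rep flip: e')
    finally have "\<rho> (cl_vec e) (\<rho> d (\<rho> (cl_vec e) t)) = 0" by simp
    then have "\<rho> (cl_vec e) (\<rho> d s) = 0" by (simp add: t_def ee)
    then show "\<rho> d s = 0" using ee[of "\<rho> d s"] by (simp add: rep)
  qed
  have sq: "clifford_square a f (cl_vec e) + cl_vec (B e) \<in> rep_kernel \<rho>" for e
  proof -
    have "\<rho> (clifford_square a f (cl_vec e) + cl_vec (B e)) t = 0" for t
    proof -
      have "sqrt 2 *\<^sub>R \<rho> (clifford_square a f (cl_vec e) + cl_vec (B e)) t = 0"
        using arg_cong[OF br[of cw_q "cw_vec e" "(0, t)"], of fst]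
        by (simp add: cw_brackets(1)[OF b B] flat q vec d0 clifford_square_def rep scaleR_2 algebra_simps)
      then show ?thesis by simp
    qed
    then show ?thesis by (simp add: rep_kernel_def fun_eq_iff)
  qed
  obtain c1 c2 where c12: "c1 - a \<in> rep_kernel \<rho>" "c2 - f \<in> rep_kernel \<rho>"
    "quadratic_clifford_equation B c1 c2"
    by (rule quadratic_clifford_equation_lift[OF rep_kernel_ideal[OF irr] sq])
  then have eq: "\<rho> a = \<rho> c1" "\<rho> f = \<rho> c2" by (simp_all add: rep_kernel_diff[OF irr])
  show ?thesis
  proof (rule that[OF c12(3)])
    show "R cw_q = block (\<rho> c1) (\<rho> c) (\<lambda>s. 0) (\<rho> c2)" by (simp add: q d0 eq)
    show "R (cw_vec e) = block (\<lambda>s. 0)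
      (\<lambda>s. sqrt 2 *\<^sub>R (\<rho> (cl_vec e) (\<rho> c2 s) - \<rho> c1 (\<rho> (cl_vec e) s))) (\<lambda>s. 0) (\<lambda>s. 0)" for e
      by (auto simp: vec d0 eq rep)
  qed
qed

lemma cw_rep_zero_charge:
  assumes b: "nondegenerate_symmetric_form b" and B: "\<And>e f. b e f = - \<langle>B e,f\<rangle>"
    and quad: "quadratic_clifford_equation B c1 c2"
  shows "zero_charge_spin_representation \<rho> b B (cw_rep \<rho> B c1 c2 c3)"
proof -
  have linB: "linear B" using cw_operator[OF b B] by simp
  note lins = linear_add[OF linB] linear_diff[OF linB] linear_cmul[OF linB] linear_0[OF linB]
    linear_diff[OF linear_flat] linear_add[OF linear_sharp] linear_diff[OF linear_sharp] linear_cmul[OF linear_sharp]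
    linear_diff[OF linear_cl_vec] linear_add[OF linear_cl_vec] linear_cmul[OF linear_cl_vec] linear_0[OF linear_cl_vec]
  have quad': "\<rho> (cl_vec (B e)) s = \<rho> c1 (\<rho> (cl_vec e) (\<rho> c2 s)) + \<rho> c1 (\<rho> (cl_vec e) (\<rho> c2 s))
      - \<rho> c1 (\<rho> c1 (\<rho> (cl_vec e) s)) - \<rho> (cl_vec e) (\<rho> c2 (\<rho> c2 s))" for e s
  proof -
    have "- (- \<rho> (cl_vec (B e)) s) = 2 *\<^sub>R \<rho> c1 (\<rho> (cl_vec e) (\<rho> c2 s))
      - \<rho> c1 (\<rho> c1 (\<rho> (cl_vec e) s)) - \<rho> (cl_vec e) (\<rho> c2 (\<rho> c2 s))"
      unfolding quadratic_clifford_equation_rep[OF quad, symmetric] by simp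
    then show ?thesis by (simp add: scaleR_2)
  qed
  let ?R = "cw_rep \<rho> B c1 c2 c3"
  have "linear (?R X)" for X
    by (cases X) (auto intro!: linearI simp: cw_rep_def rep algebra_simps)
  moreover have "linear (\<lambda>X. ?R X Q)" for Q
    by (cases Q) (auto intro!: linearI simp: cw_rep_def rep lins algebra_simps)
  moreover have "?R (cw_bracket b B X Y) Q = ?R X (?R Y Q) - ?R Y (?R X Q)" for X Y Q
  proof -
    obtain \<phi> e x y where X: "X = (\<phi>, e, x, y)" by (cases X) auto
    obtain \<phi>' e' x' y' where Y: "Y = (\<phi>', e', x', y')" by (cases Y) auto
    obtain s t where Q: "Q = (s, t)" by (cases Q)
    show ?thesis
      by (simp add: X Y Q cw_rep_def cw_bracket_def rep lins quad'[of e] quad'[of e'])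
        (simp add: algebra_simps)
  qed
  ultimately have "lie_representation (cw_bracket b B) ?R"
    by (simp add: lie_representation_def)
  moreover have "?R X \<in> range (rho_spin \<rho>)" for X
    by (cases X) (simp add: cw_rep_def rho_spin_range_upper)
  ultimately show ?thesis
    by (auto simp: zero_charge_spin_representation_def spin_representation_def cw_rep_def
        cw_dual_def cw_p_def rep lins fun_eq_iff zero_prod_def)
qed

end


section \<open>Superizations\<close>

text \<open>
  A Lie superalgebra amounts to a Lie algebra, a module, and a symmetric equivariant bilinear map
  \<open>\<Gamma>\<close> from the module to the Lie algebra, subject to the Jacobi identity for three odd elements.
  The latter is trivial when the values of \<open>\<Gamma>\<close> act by zero.
\<close>

definition super_bracket ::
    "('g::real_vector \<Rightarrow> 'g \<Rightarrow> 'g) \<Rightarrow> ('g \<Rightarrow> 'v::real_vector \<Rightarrow> 'v) \<Rightarrow> ('v \<Rightarrow> 'v \<Rightarrow> 'g) \<Rightarrow>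
     'g \<times> 'v \<Rightarrow> 'g \<times> 'v \<Rightarrow> 'g \<times> 'v"
  where "super_bracket lb R \<Gamma> = (\<lambda>(X, Q) (Y, Q'). (lb X Y + \<Gamma> Q Q', R X Q' - R Y Q))"

lemma super_bracket_lie_superalgebra:
  assumes lb: "bilinear lb" "\<And>X Y. lb X Y = - lb Y X"
      "\<And>X Y Z. lb X (lb Y Z) = lb (lb X Y) Z + lb Y (lb X Z)"
    and R: "lie_representation lb R"
    and \<Gamma>: "bilinear \<Gamma>" "\<And>Q Q'. \<Gamma> Q Q' = \<Gamma> Q' Q"
      "\<And>X Q Q'. lb X (\<Gamma> Q Q') = \<Gamma> (R X Q) Q' + \<Gamma> Q (R X Q')"
    and R\<Gamma>: "\<And>Q Q' Q''. R (\<Gamma> Q Q') Q'' = 0"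
  shows "lie_superalgebra (super_bracket lb R \<Gamma>)"
proof -
  let ?br = "super_bracket lb R \<Gamma>"
  have linR: "linear (R X)" "linear (\<lambda>X. R X v)" for X v
    using R by (simp_all add: lie_representation_def)
  have Rlb: "R (lb X Y) v = R X (R Y v) - R Y (R X v)" for X Y v
    using R unfolding lie_representation_def by blast
  note lins = linear_add[OF linR(1)] linear_diff[OF linR(1)] linear_neg[OF linR(1)]
    linear_cmul[OF linR(1)] linear_0[OF linR(1)]
    linear_add[OF linR(2)] linear_diff[OF linR(2)] linear_neg[OF linR(2)]
    linear_cmul[OF linR(2)] linear_0[OF linR(2)]
    bilinear_ladd[OF lb(1)] bilinear_radd[OF lb(1)] bilinear_lmul[OF lb(1)] bilinear_rmul[OF lb(1)]
    bilinear_lzero[OF lb(1)] bilinear_rzero[OF lb(1)] bilinear_lneg[OF lb(1)] bilinear_rneg[OF lb(1)]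
    bilinear_ladd[OF \<Gamma>(1)] bilinear_radd[OF \<Gamma>(1)] bilinear_lmul[OF \<Gamma>(1)] bilinear_rmul[OF \<Gamma>(1)]
    bilinear_lzero[OF \<Gamma>(1)] bilinear_rzero[OF \<Gamma>(1)] bilinear_lneg[OF \<Gamma>(1)] bilinear_rneg[OF \<Gamma>(1)]
    bilinear_rsub[OF \<Gamma>(1)] bilinear_lsub[OF \<Gamma>(1)]
  have even: "?br (X, 0) (Y, Q) = (lb X Y, R X Q)" for X Y Q
    by (simp add: super_bracket_def lins)
  have odd: "?br (0, Q) (Y, Q') = (\<Gamma> Q Q', - R Y Q)" for Y Q Q'
    by (simp add: super_bracket_def lins)
  have bil: "bilinear ?br"
    unfolding bilinear_def
    by (intro conjI allI linearI) (auto simp: super_bracket_def lins algebra_simps split: prod.splits)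
  have hom: "x \<in> homogeneous i \<longleftrightarrow> (if even i then \<exists>X. x = (X, 0) else \<exists>Q. x = (0, Q))"
    for x :: "'a \<times> 'b" and i
    by (cases x) (auto simp: homogeneous_def)
  have grad: "?br x y \<in> homogeneous (i + j)" if "x \<in> homogeneous i" "y \<in> homogeneous j" for x y i j
    using that by (cases "even i"; cases "even j") (auto simp: hom even odd lins)
  have skew: "?br x y = - ((-1) ^ (i * j) *\<^sub>R ?br y x)"
    if ij: "i \<in> {0, 1}" "j \<in> {0, 1}" "x \<in> homogeneous i" "y \<in> homogeneous j" for x y and i j :: nat
  proof -
    consider X Y where "i = 0" "j = 0" "x = (X, 0)" "y = (Y, 0)" | X Q where "i = 0" "j = 1" "x = (X, 0)" "y = (0, Q)"
      | X Q where "i = 1" "j = 0" "x = (0, Q)" "y = (X, 0)" | Q Q' where "i = 1" "j = 1" "x = (0, Q)" "y = (0, Q')"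
      using ij by (auto simp: hom)
    then show ?thesis
    proof cases
      case (1 X Y)
      then show ?thesis using lb(2)[of X Y] by (simp add: even lins)
    next
      case (4 Q Q')
      then show ?thesis using \<Gamma>(2)[of Q Q'] by (simp add: odd lins)
    qed (simp_all add: even odd lins)
  qed
  have jac: "?br x (?br y z) = ?br (?br x y) z + (-1) ^ (i * j) *\<^sub>R ?br y (?br x z)"
    if ij: "i \<in> {0, 1}" "j \<in> {0, 1}" "x \<in> homogeneous i" "y \<in> homogeneous j" for x y z and i j :: nat
  proof -
    obtain Z S where z: "z = (Z, S)" by (cases z)
    consider X Y where "i = 0" "j = 0" "x = (X, 0)" "y = (Y, 0)" | X Q where "i = 0" "j = 1" "x = (X, 0)" "y = (0, Q)"
      | X Q where "i = 1" "j = 0" "x = (0, Q)" "y = (X, 0)" | Q Q' where "i = 1" "j = 1" "x = (0, Q)" "y = (0, Q')"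
      using ij by (auto simp: hom)
    then show ?thesis
    proof cases
      case (1 X Y)
      then show ?thesis using lb(3)[of X Y Z] Rlb[of X Y S] by (simp add: z even lins)
    next
      case (2 X Q)
      then show ?thesis using \<Gamma>(3)[of X Q S] Rlb[of X Z Q] by (simp add: z even odd lins)
    next
      case (3 X Q)
      then show ?thesis using \<Gamma>(3)[of X Q S] Rlb[of X Z Q] by (simp add: z even odd lins)
    next
      case (4 Q Q')
      have "lb (\<Gamma> Q Q') Z = - (\<Gamma> (R Z Q) Q' + \<Gamma> Q (R Z Q'))"
        using lb(2)[of "\<Gamma> Q Q'" Z] \<Gamma>(3)[of Z Q Q'] by simp
      then show ?thesis
        using 4 \<Gamma>(2)[of Q' "R Z Q"] by (simp add: z even odd lins R\<Gamma>)
    qed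
  qed
  show ?thesis
    unfolding lie_superalgebra_def
    by (intro conjI allI ballI bil grad skew jac; assumption)
qed

lemma lie_superalgebra_brackets:
  fixes br :: "'g::real_vector \<times> 'v::real_vector \<Rightarrow> 'g \<times> 'v \<Rightarrow> 'g \<times> 'v"
  assumes "lie_superalgebra br"
  shows "br (X, 0) (0, Q) = (0, ad_odd br X Q)" and "br (0, Q) (X, 0) = (0, - ad_odd br X Q)"
    and "br (0, Q) (0, Q') = (fst (br (0, Q) (0, Q')), 0)"
    and "br (0, Q) (0, Q') = br (0, Q') (0, Q)"
    and "br (X, 0) (br (0, Q) (0, Q')) = br (0, ad_odd br X Q) (0, Q') + br (0, Q) (0, ad_odd br X Q')"
    and "bilinear br" and "linear (\<lambda>X. ad_odd br X Q)"
proof -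
  have even: "(X, 0) \<in> homogeneous 0" and odd: "(0, Q) \<in> homogeneous 1" for X :: 'g and Q :: 'v
    by (simp_all add: homogeneous_def)
  have grad: "\<And>i j x y. x \<in> homogeneous i \<Longrightarrow> y \<in> homogeneous j \<Longrightarrow> br x y \<in> homogeneous (i + j)"
    and skew: "\<And>i j x y. i \<in> {0, 1} \<Longrightarrow> j \<in> {0, 1} \<Longrightarrow> x \<in> homogeneous i \<Longrightarrow> y \<in> homogeneous j \<Longrightarrow>
      br x y = - ((-1) ^ (i * j) *\<^sub>R br y x)"
    and jac: "\<And>i j x y z. i \<in> {0, 1} \<Longrightarrow> j \<in> {0, 1} \<Longrightarrow> x \<in> homogeneous i \<Longrightarrow> y \<in> homogeneous j \<Longrightarrow>
      br x (br y z) = br (br x y) z + (-1) ^ (i * j) *\<^sub>R br y (br x z)"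
    and bil: "bilinear br"
    using assms unfolding lie_superalgebra_def by blast+
  show eo: "br (X, 0) (0, Q) = (0, ad_odd br X Q)" for X Q
    using grad[OF even odd, of X Q] by (auto simp: homogeneous_def ad_odd_def)
  show "br (0, Q) (X, 0) = (0, - ad_odd br X Q)"
    using skew[OF _ _ odd even, of Q X] by (simp add: eo)
  show "br (0, Q) (0, Q') = (fst (br (0, Q) (0, Q')), 0)"
    using grad[OF odd odd, of Q Q'] by (auto simp: homogeneous_def)
  show "br (0, Q) (0, Q') = br (0, Q') (0, Q)"
    using skew[OF _ _ odd odd, of Q Q'] by simp
  show "br (X, 0) (br (0, Q) (0, Q')) = br (0, ad_odd br X Q) (0, Q') + br (0, Q) (0, ad_odd br X Q')"
    using jac[OF _ _ even odd, of X Q "(0, Q')"] by (simp add: eo)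
  show "bilinear br" by (rule bil)
  have "(X + Y, 0) = (X, 0 :: 'v) + (Y, 0)" "(a *\<^sub>R X, 0) = a *\<^sub>R (X, 0 :: 'v)" for X Y :: 'g and a
    by simp_all
  then show "linear (\<lambda>X. ad_odd br X Q)"
    unfolding ad_odd_def by (intro linearI) (simp_all only: bilinear_ladd[OF bil] bilinear_lmul[OF bil] snd_add snd_scaleR)
qed

lemma symmetric_bilinear_eqI:
  assumes f: "bilinear f" "\<And>x y. f x y = f y x" and g: "bilinear g" "\<And>x y. g x y = g y x"
    and diag: "\<And>x. f x x = g x x"
  shows "f x y = g x y"
proof -
  have "f (x + y) (x + y) = f x x + f y y + 2 *\<^sub>R f x y"
    using f(2)[of x y] by (simp add: bilinear_ladd[OF f(1)] bilinear_radd[OF f(1)] scaleR_2)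
  moreover have "g (x + y) (x + y) = g x x + g y y + 2 *\<^sub>R g x y"
    using g(2)[of x y] by (simp add: bilinear_ladd[OF g(1)] bilinear_radd[OF g(1)] scaleR_2)
  ultimately have "2 *\<^sub>R f x y = 2 *\<^sub>R g x y" using diag by simp
  then show ?thesis by simp
qed

lemma lie_superalgebra_eqI:
  fixes br br' :: "'g::real_vector \<times> 'v::real_vector \<Rightarrow> 'g \<times> 'v \<Rightarrow> 'g \<times> 'v"
  assumes br: "lie_superalgebra br" and br': "lie_superalgebra br'"
    and even: "\<And>X Y. br (X, 0) (Y, 0) = br' (X, 0) (Y, 0)"
    and ad: "\<And>X. ad_odd br X = ad_odd br' X"
    and odd: "\<And>Q. br (0, Q) (0, Q) = br' (0, Q) (0, Q)"
  shows "br = br'"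
proof (intro ext)
  note b = lie_superalgebra_brackets[OF br] and b' = lie_superalgebra_brackets[OF br']
  have lin: "(0, Q + Q') = (0 :: 'g, Q) + (0, Q')" "(0, a *\<^sub>R Q) = a *\<^sub>R (0 :: 'g, Q)" for Q Q' :: 'v and a
    by simp_all
  have bil: "bilinear (\<lambda>Q Q'. f (0, Q) (0, Q'))"
    if "bilinear f" for f :: "'g \<times> 'v \<Rightarrow> 'g \<times> 'v \<Rightarrow> 'g \<times> 'v"
    unfolding bilinear_def
    by (intro conjI allI linearI)
      (simp_all only: lin bilinear_ladd[OF that] bilinear_radd[OF that] bilinear_lmul[OF that] bilinear_rmul[OF that])
  have oo: "br (0, Q) (0, Q') = br' (0, Q) (0, Q')" for Q Q'
    by (rule symmetric_bilinear_eqI[where f = "\<lambda>Q Q'. br (0, Q) (0, Q')"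
        and g = "\<lambda>Q Q'. br' (0, Q) (0, Q')", OF bil[OF b(6)] b(4) bil[OF b'(6)] b'(4) odd])
  fix x y :: "'g \<times> 'v"
  obtain X Q Y Q' where "x = (X, 0) + (0, Q)" "y = (Y, 0) + (0, Q')"
    by (cases x; cases y) auto
  then show "br x y = br' x y"
    by (simp only: bilinear_ladd[OF b(6)] bilinear_radd[OF b(6)] bilinear_ladd[OF b'(6)]
        bilinear_radd[OF b'(6)] even oo b(1,2) b'(1,2) ad)
qed

text \<open>
  The bracket of odd elements is this form times \<open>p\<close>: the polarization of the quadratic form in
  the theorem.
\<close>

definition odd_form :: "('s::real_vector \<Rightarrow> 's \<Rightarrow> real) \<Rightarrow> ('s \<Rightarrow> 's \<Rightarrow> real) \<Rightarrow> 's \<times> 's \<Rightarrow> 's \<times> 's \<Rightarrow> real"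
  where "odd_form pmp ppp = (\<lambda>(s, t) (s', t'). ppp t t' + pmp s t' + pmp s' t)"

lemma odd_form_bilinear:
  assumes "bilinear pmp" "bilinear ppp"
  shows "bilinear (odd_form pmp ppp)"
  unfolding bilinear_def odd_form_def
  by (intro conjI allI linearI)
    (auto simp: bilinear_ladd[OF assms(1)] bilinear_radd[OF assms(1)] bilinear_lmul[OF assms(1)]
      bilinear_rmul[OF assms(1)] bilinear_ladd[OF assms(2)] bilinear_radd[OF assms(2)]
      bilinear_lmul[OF assms(2)] bilinear_rmul[OF assms(2)] algebra_simps split: prod.splits)

lemma odd_form_symmetric:
  assumes "\<And>s t. ppp s t = ppp t s"
  shows "odd_form pmp ppp Q Q' = odd_form pmp ppp Q' Q"
  using assms[of "snd Q" "snd Q'"] by (cases Q; cases Q') (simp add: odd_form_def)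

lemma odd_form_inject:
  assumes p: "bilinear pmp" "bilinear ppp" and r: "bilinear rmp" "bilinear rpp"
    and eq: "odd_form pmp ppp = odd_form rmp rpp"
  shows "pmp = rmp" "ppp = rpp"
proof -
  have eq': "odd_form pmp ppp Q Q' = odd_form rmp rpp Q Q'" for Q Q' using eq by simp
  show "pmp = rmp"
    by (intro ext) (use eq'[of "(_, 0)" "(0, _)"] in \<open>simp add: odd_form_def p r bilinear_lzero bilinear_rzero\<close>)
  show "ppp = rpp"
    by (intro ext) (use eq'[of "(0, _)" "(0, _)"] in \<open>simp add: odd_form_def p r bilinear_lzero bilinear_rzero\<close>)
qed


section \<open>Zero charge superizations with translational supersymmetry\<close>

context
  fixes \<rho> :: "'e::euclidean_space clifford \<Rightarrow> 's::real_vector \<Rightarrow> 's"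
    and b :: "'e \<Rightarrow> 'e \<Rightarrow> real" and B :: "'e \<Rightarrow> 'e"
  assumes irr: "irreducible_representation \<rho>"
    and b: "nondegenerate_symmetric_form b" and B: "\<And>e f. b e f = - \<langle>B e,f\<rangle>"
begin

lemmas repr = rep_simps[OF irr]

lemma superization_dataD:
  assumes "superization_data \<rho> B c1 c2 c3 pmp ppp"
  shows "quadratic_clifford_equation B c1 c2"
    and "bilinear pmp" and "\<And>e s t. pmp (\<rho> (cl_vec e) s) t = - pmp (\<rho> (cl_vec e) t) s"
    and "bilinear ppp" and "\<And>s t. ppp s t = ppp t s"
    and "\<And>s t. pmp (\<rho> c3 s) t + pmp (\<rho> c3 t) s + ppp (\<rho> c2 s) t + ppp s (\<rho> c2 t) = 0"
    and "\<And>s t. pmp (\<rho> c1 s) t = - pmp s (\<rho> c2 t)"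
  using assms unfolding superization_data_def bil_minus_iff[OF irr] symmetric_forms_def
  by (blast | metis add_eq_0_iff2)+

definition superization :: "'e clifford \<Rightarrow> 'e clifford \<Rightarrow> 'e clifford \<Rightarrow>
    ('s \<Rightarrow> 's \<Rightarrow> real) \<Rightarrow> ('s \<Rightarrow> 's \<Rightarrow> real) \<Rightarrow> 'e cw \<times> ('s \<times> 's) \<Rightarrow> 'e cw \<times> ('s \<times> 's) \<Rightarrow> 'e cw \<times> ('s \<times> 's)"
  where "superization c1 c2 c3 pmp ppp =
    super_bracket (cw_bracket b B) (cw_rep \<rho> B c1 c2 c3) (\<lambda>Q Q'. odd_form pmp ppp Q Q' *\<^sub>R cw_p)"

text \<open>
  For \<open>q\<close> this is the pair of compatibility conditions and for \<open>e\<^sup>\<flat>\<close> the defining identity of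
  \<open>\<tau>\<sigma> = -1\<close>.  For \<open>e \<in> E\<close> it is a consequence of both, since \<open>E\<close> is generated by the brackets
  of \<open>E\<^sup>*\<close> with \<open>q\<close>.
\<close>

lemma odd_form_cw_rep:
  assumes data: "superization_data \<rho> B c1 c2 c3 pmp ppp"
  shows "odd_form pmp ppp (cw_rep \<rho> B c1 c2 c3 X Q) Q'
    + odd_form pmp ppp Q (cw_rep \<rho> B c1 c2 c3 X Q') = 0"
proof -
  note d = superization_dataD[OF data]
  note bil = bilinear_ladd[OF d(2)] bilinear_radd[OF d(2)] bilinear_lmul[OF d(2)] bilinear_rmul[OF d(2)]
    bilinear_lsub[OF d(2)] bilinear_ladd[OF d(4)] bilinear_radd[OF d(4)] bilinear_lmul[OF d(4)] bilinear_rmul[OF d(4)]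
  obtain \<phi> e x y where X: "X = (\<phi>, e, x, y)" by (cases X) auto
  obtain s t s' t' where Q: "Q = (s, t)" "Q' = (s', t')" by (cases Q; cases Q') auto
  let ?u = "B (sharp \<phi>)"
  have "odd_form pmp ppp (cw_rep \<rho> B c1 c2 c3 X Q) Q' + odd_form pmp ppp Q (cw_rep \<rho> B c1 c2 c3 X Q')
      = y * (pmp (\<rho> c3 t) t' + pmp (\<rho> c3 t') t + ppp (\<rho> c2 t) t' + ppp t (\<rho> c2 t'))
      + y * (pmp (\<rho> c1 s) t' + pmp s (\<rho> c2 t')) + y * (pmp (\<rho> c1 s') t + pmp s' (\<rho> c2 t))
      + sqrt 2 * (pmp (\<rho> (cl_vec ?u) t) t' + pmp (\<rho> (cl_vec ?u) t') t)
      + sqrt 2 * (pmp (\<rho> (cl_vec e) (\<rho> c2 t)) t' - pmp (\<rho> c1 (\<rho> (cl_vec e) t')) t)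
      + sqrt 2 * (pmp (\<rho> (cl_vec e) (\<rho> c2 t')) t - pmp (\<rho> c1 (\<rho> (cl_vec e) t)) t')"
    by (simp add: X Q odd_form_def cw_rep_def repr bil algebra_simps)
  moreover have "pmp (\<rho> (cl_vec e) (\<rho> c2 t)) t' = pmp (\<rho> c1 (\<rho> (cl_vec e) t')) t" for t t'
    unfolding d(7) d(3)[of e "\<rho> c2 t"] ..
  ultimately show ?thesis
    using d(6)[of t t'] d(7)[of s t'] d(7)[of s' t] d(3)[of ?u t t'] by simp
qed

lemma superization_correct:
  assumes data: "superization_data \<rho> B c1 c2 c3 pmp ppp"
  defines "br \<equiv> superization c1 c2 c3 pmp ppp"
  shows "zero_charge_superization \<rho> b B br" and "translational_supersymmetry br"
    and "superization_given_by \<rho> B c1 c2 c3 pmp ppp br"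
proof -
  let ?R = "cw_rep \<rho> B c1 c2 c3"
  note d = superization_dataD[OF data]
  have br: "br = super_bracket (cw_bracket b B) ?R (\<lambda>Q Q'. odd_form pmp ppp Q Q' *\<^sub>R cw_p)"
    by (simp add: br_def superization_def)
  have R: "zero_charge_spin_representation \<rho> b B ?R"
    by (rule cw_rep_zero_charge[OF irr b B d(1)])
  have lie: "lie_representation (cw_bracket b B) ?R" and p0: "?R cw_p = (\<lambda>Q. 0)"
    using R by (simp_all add: zero_charge_spin_representation_def spin_representation_def)
  have linR: "linear (?R X)" "linear (\<lambda>X. ?R X Q)" for X Q
    using lie unfolding lie_representation_def by blast+
  note bilcw = cw_brackets(8)[OF b B]
  have bil: "bilinear (odd_form pmp ppp)"
    by (rule odd_form_bilinear[OF d(2,4)])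
  have sym: "odd_form pmp ppp Q Q' = odd_form pmp ppp Q' Q" for Q Q'
    by (rule odd_form_symmetric[OF d(5)])
  have cent: "cw_bracket b B X (a *\<^sub>R cw_p) = 0" for X a
    using cw_brackets(5)[OF b B, of X] cw_brackets(4)[OF b B, of X cw_p]
    by (simp add: bilinear_rmul[OF bilcw])
  have ad: "ad_odd br X = ?R X" for X
    by (rule ext) (simp add: ad_odd_def br super_bracket_def linear_0[OF linR(1)])
  have "lie_superalgebra br"
    unfolding br
  proof (rule super_bracket_lie_superalgebra[OF bilcw cw_brackets(4)[OF b B] cw_jacobi[OF b B] lie])
    show "bilinear (\<lambda>Q Q'. odd_form pmp ppp Q Q' *\<^sub>R (cw_p :: 'e cw))"
      unfolding bilinear_def
      by (intro conjI allI linearI)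
        (simp_all add: bilinear_ladd[OF bil] bilinear_radd[OF bil] bilinear_lmul[OF bil]
          bilinear_rmul[OF bil] scaleR_add_left)
    show "odd_form pmp ppp Q Q' *\<^sub>R cw_p = odd_form pmp ppp Q' Q *\<^sub>R (cw_p :: 'e cw)" for Q Q'
      by (simp add: sym[of Q Q'])
    show "cw_bracket b B X (odd_form pmp ppp Q Q' *\<^sub>R cw_p)
        = odd_form pmp ppp (?R X Q) Q' *\<^sub>R cw_p + odd_form pmp ppp Q (?R X Q') *\<^sub>R cw_p" for X Q Q'
      using odd_form_cw_rep[OF data, of X Q Q'] by (simp add: cent flip: scaleR_add_left)
    show "?R (odd_form pmp ppp Q Q' *\<^sub>R cw_p) Q'' = 0" for Q Q' Q''
      using p0 by (simp add: linear_cmul[OF linR(2)])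
  qed
  moreover have "ad_odd br = ?R" by (rule ext) (rule ad)
  moreover have "br (X, 0) (Y, 0) = (cw_bracket b B X Y, 0)" for X Y
    using bilinear_lzero[OF bil, of 0] by (simp only: br super_bracket_def prod.case linear_0[OF linR(1)]) simp
  ultimately show "zero_charge_superization \<rho> b B br"
    using R by (simp only: zero_charge_superization_def simp_thms)
  have cw0: "cw_bracket b B 0 0 = 0" by (rule bilinear_lzero[OF bilcw])
  show "translational_supersymmetry br"
    by (simp add: translational_supersymmetry_def br super_bracket_def cw0 linear_0[OF linR(2)]
        cw_m_def cw_p_def)
  have "br (0, Q) (0, Q) = (odd_form pmp ppp Q Q *\<^sub>R cw_p, 0)" for Q
    by (simp add: br super_bracket_def cw0)
  then show "superization_given_by \<rho> B c1 c2 c3 pmp ppp br"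
    unfolding superization_given_by_def ad
    by (auto simp: odd_form_def cw_rep_def cw_p_def cw_q_def cw_dual_def cw_vec_def repr
        vec_op_linear[OF irr] linear_0[OF cw_operator(1)[OF b B]] fun_eq_iff)
qed

lemma superization_unique:
  assumes br: "zero_charge_superization \<rho> b B br" "superization_given_by \<rho> B c1 c2 c3 pmp ppp br"
    and br': "zero_charge_superization \<rho> b B br'" "superization_given_by \<rho> B c1 c2 c3 pmp ppp br'"
  shows "br = br'"
proof (rule lie_superalgebra_eqI)
  show sa: "lie_superalgebra br" "lie_superalgebra br'"
    using br br' by (simp_all add: zero_charge_superization_def)
  show "br (X, 0) (Y, 0) = br' (X, 0) (Y, 0)" for X Y
    using br br' unfolding zero_charge_superization_def by metis
  show "br (0, Q) (0, Q) = br' (0, Q) (0, Q)" for Q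
    using br br' by (cases Q) (simp add: superization_given_by_def)
  show "ad_odd br X = ad_odd br' X" for X
  proof
    fix Q
    obtain \<phi> e x y where X: "X = (\<phi>, e, x, y)" by (cases X) auto
    note l = lie_superalgebra_brackets(7)[OF sa(1)] and l' = lie_superalgebra_brackets(7)[OF sa(2)]
    have "ad_odd br cw_p = ad_odd br' cw_p" "ad_odd br cw_q = ad_odd br' cw_q"
      "ad_odd br (cw_vec e) = ad_odd br' (cw_vec e)"
      "ad_odd br (cw_dual (flat (sharp \<phi>))) = ad_odd br' (cw_dual (flat (sharp \<phi>)))"
      using br br' unfolding superization_given_by_def by metis+
    then show "ad_odd br X Q = ad_odd br' X Q"
      unfolding X cw_decompose
      by (simp only: linear_add[OF l] linear_cmul[OF l] linear_add[OF l'] linear_cmul[OF l'])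
  qed
qed

text \<open>
  The bracket \<open>\<Gamma>\<close> of odd elements takes its values in \<open>m\<close>.  Equivariance under \<open>e\<close> and \<open>q\<close> forces
  it into \<open>\<real> p\<close>, because \<open>[q,e] = e\<^sup>\<flat>\<close> leaves \<open>m\<close>; so \<open>\<Gamma> = \<gamma> p\<close> with an invariant form \<open>\<gamma>\<close>.
  Invariance under \<open>e\<^sup>\<flat>\<close> makes \<open>S\<^sub>-\<close> isotropic and gives the \<open>\<tau>\<sigma> = -1\<close> identity; invariance
  under \<open>q\<close> gives the compatibility conditions.
\<close>

lemma superization_classified:
  assumes br: "zero_charge_superization \<rho> b B br" and tr: "translational_supersymmetry br"
  obtains c1 c2 c3 pmp ppp where "superization_data \<rho> B c1 c2 c3 pmp ppp"
    "superization_given_by \<rho> B c1 c2 c3 pmp ppp br"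
proof -
  let ?R = "ad_odd br"
  have sa: "lie_superalgebra br" and even: "\<And>X Y. br (X, 0) (Y, 0) = (cw_bracket b B X Y, 0)"
    and R: "zero_charge_spin_representation \<rho> b B ?R"
    using br unfolding zero_charge_superization_def by blast+
  note sab = lie_superalgebra_brackets[OF sa]
  have flat: "\<And>e. ?R (cw_dual (flat e)) =
      block (\<lambda>s. 0) (\<lambda>s. sqrt 2 *\<^sub>R \<rho> (cl_vec (B e)) s) (\<lambda>s. 0) (\<lambda>s. 0)"
    and p0: "?R cw_p = (\<lambda>Q. 0)"
    using R by (simp_all add: zero_charge_spin_representation_def spin_representation_def)
  obtain c1 c2 c3 where quad: "quadratic_clifford_equation B c1 c2"
    and q: "?R cw_q = block (\<rho> c1) (\<rho> c3) (\<lambda>s. 0) (\<rho> c2)"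
    and vec: "\<And>e. ?R (cw_vec e) = block (\<lambda>s. 0)
      (\<lambda>s. sqrt 2 *\<^sub>R (\<rho> (cl_vec e) (\<rho> c2 s) - \<rho> c1 (\<rho> (cl_vec e) s))) (\<lambda>s. 0) (\<lambda>s. 0)"
    by (rule zero_charge_representation_form[OF irr b B R]) blast
  define \<Gamma> where "\<Gamma> Q Q' = fst (br (0, Q) (0, Q'))" for Q Q'
  have br\<Gamma>: "br (0, Q) (0, Q') = (\<Gamma> Q Q', 0)" for Q Q'
    unfolding \<Gamma>_def by (rule sab(3))
  have \<Gamma>0: "fst (\<Gamma> Q Q') = 0" for Q Q'
    using tr by (simp add: translational_supersymmetry_def cw_m_def br\<Gamma> del: split_paired_All)
  have equi: "cw_bracket b B X (\<Gamma> Q Q') = \<Gamma> (?R X Q) Q' + \<Gamma> Q (?R X Q')" for X Q Q'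
    using sab(5)[of X Q Q'] by (simp add: br\<Gamma> even)
  define \<gamma> where "\<gamma> Q Q' = fst (snd (snd (\<Gamma> Q Q')))" for Q Q'
  have \<Gamma>: "\<Gamma> Q Q' = \<gamma> Q Q' *\<^sub>R cw_p" for Q Q'
  proof -
    obtain e x y where E: "\<Gamma> Q Q' = (0, e, x, y)"
      using \<Gamma>0[of Q Q'] by (cases "\<Gamma> Q Q'") auto
    have "fst (cw_bracket b B X (\<Gamma> Q Q')) = 0" for X
      by (simp add: equi \<Gamma>0)
    note * = this[unfolded E]
    have flat0: "flat 0 = (0 :: 'e \<Rightarrow>\<^sub>L real)" by (rule linear_0[OF linear_flat])
    obtain u :: 'e where "u \<bullet> u = 1" by (rule unit_vector[OF irr])
    then have "flat u \<noteq> 0" using flat_inject[of u 0] by (auto simp: flat0)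
    then have "y = 0"
      using *[of "cw_vec u"] by (simp add: cw_bracket_def cw_vec_def)
    moreover have "flat e = 0"
      using *[of cw_q] by (simp add: cw_bracket_def cw_q_def flat0)
    then have "e = 0" using flat_inject[of e 0] by (simp add: flat0)
    ultimately show ?thesis by (simp add: \<gamma>_def E cw_p_def)
  qed
  have inv: "\<gamma> (?R X Q) Q' + \<gamma> Q (?R X Q') = 0" for X Q Q'
  proof -
    have "cw_bracket b B X (a *\<^sub>R cw_p) = 0" for a
      using cw_brackets(5)[OF b B, of X] cw_brackets(4)[OF b B, of X cw_p]
      by (simp add: bilinear_rmul[OF cw_brackets(8)[OF b B]])
    then show ?thesis
      using equi[of X Q Q'] by (simp add: \<Gamma> cw_p_def zero_prod_def flip: scaleR_add_left)
  qed
  have lin: "(0, Q + Q') = (0 :: 'e cw, Q) + (0, Q')" "(0, a *\<^sub>R Q) = a *\<^sub>R (0 :: 'e cw, Q)" for Q Q' :: "'s \<times> 's" and a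
    by simp_all
  have bil: "bilinear \<gamma>"
    unfolding bilinear_def \<gamma>_def \<Gamma>_def
    by (intro conjI allI linearI)
      (simp_all only: lin bilinear_ladd[OF sab(6)] bilinear_radd[OF sab(6)] bilinear_lmul[OF sab(6)]
        bilinear_rmul[OF sab(6)] fst_add snd_add fst_scaleR snd_scaleR real_scaleR_def)
  have sym: "\<gamma> Q Q' = \<gamma> Q' Q" for Q Q'
    unfolding \<gamma>_def \<Gamma>_def by (subst sab(4)) (rule refl)
  define pmp where "pmp s t = \<gamma> (s, 0) (0, t)" for s t
  define ppp where "ppp s t = \<gamma> (0, s) (0, t)" for s t
  have lin1: "(s + t, 0) = (s, 0 :: 's) + (t, 0)" "(a *\<^sub>R s, 0) = a *\<^sub>R (s, 0 :: 's)"
    "(0, s + t) = (0 :: 's, s) + (0, t)" "(0, a *\<^sub>R s) = a *\<^sub>R (0 :: 's, s)" for s t :: 's and a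
    by simp_all
  note bils = bilinear_ladd[OF bil] bilinear_radd[OF bil] bilinear_lmul[OF bil] bilinear_rmul[OF bil]
  have bilp: "bilinear pmp" "bilinear ppp"
    unfolding bilinear_def pmp_def ppp_def
    by (intro conjI allI linearI; simp only: lin1 bils real_scaleR_def)+
  have lin_minus: "\<gamma> (a *\<^sub>R s, 0) Q = a * \<gamma> (s, 0) Q" "\<gamma> Q (a *\<^sub>R s, 0) = a * \<gamma> Q (s, 0)" for a s Q
    by (simp_all only: lin1 bils real_scaleR_def)
  have surj: "\<exists>f. e = B f" for e using cw_operator(2)[OF b B] by (metis surjD)
  have invE: "\<gamma> (\<rho> (cl_vec e) t, 0) (s', t') + \<gamma> (s, t) (\<rho> (cl_vec e) t', 0) = 0" for e s t s' t'
  proof -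
    obtain f where f: "e = B f" using surj by blast
    have "sqrt 2 * (\<gamma> (\<rho> (cl_vec e) t, 0) (s', t') + \<gamma> (s, t) (\<rho> (cl_vec e) t', 0)) = 0"
      using inv[of "cw_dual (flat f)" "(s, t)" "(s', t')"]
      by (simp add: flat lin_minus distrib_left flip: f)
    then show ?thesis by simp
  qed
  \<comment> \<open>Every \<open>s\<close> is \<open>u (u s)\<close> for a unit vector \<open>u\<close>, so \<open>invE\<close> reaches all of \<open>S\<^sub>-\<close>.\<close>
  have pmm: "\<gamma> (s, 0) (s', 0) = 0" for s s'
  proof -
    obtain u :: 'e where u: "u \<bullet> u = 1" by (rule unit_vector[OF irr])
    have "\<gamma> (\<rho> (cl_vec u) (\<rho> (cl_vec u) s), 0) (s', 0) = 0"
      using invE[of u "\<rho> (cl_vec u) s" s' 0 0] by (simp add: repr bilinear_rzero[OF bil] flip: zero_prod_def)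
    then show ?thesis by (simp add: vec_op_square[OF irr] u)
  qed
  have odd: "\<gamma> (s, t) (s', t') = odd_form pmp ppp (s, t) (s', t')" for s t s' t'
  proof -
    have "\<gamma> ((s, 0) + (0, t)) ((s', 0) + (0, t')) = ppp t t' + pmp s t' + pmp s' t"
      unfolding bils pmp_def ppp_def using sym[of "(0, t)" "(s', 0)"] by (simp add: pmm)
    then show ?thesis by (simp add: odd_form_def)
  qed
  have skew: "pmp (\<rho> (cl_vec e) s) t = - pmp (\<rho> (cl_vec e) t) s" for e s t
    using invE[of e s 0 t 0] sym[of "(0, s)"] by (simp add: pmp_def)
  have z: "pmp 0 t = 0" "pmp s 0 = 0" "ppp 0 t = 0" "ppp s 0 = 0" for s t
    by (simp_all add: bilinear_lzero[OF bilp(1)] bilinear_lzero[OF bilp(2)]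
        bilinear_rzero[OF bilp(1)] bilinear_rzero[OF bilp(2)])
  have "pmp (\<rho> c3 s) t + pmp (\<rho> c3 t) s + ppp (\<rho> c2 s) t + ppp s (\<rho> c2 t) = 0" for s t
    using inv[of cw_q "(0, s)" "(0, t)"] by (simp add: q odd odd_form_def repr z)
  moreover have "pmp (\<rho> c1 s) t + pmp s (\<rho> c2 t) = 0" for s t
    using inv[of cw_q "(s, 0)" "(0, t)"] by (simp add: q odd odd_form_def repr z)
  moreover have "pmp \<in> bil_minus \<rho>"
    using bilp(1) skew unfolding bil_minus_iff[OF irr] by blast
  moreover have "ppp \<in> symmetric_forms"
    using bilp(2) sym unfolding symmetric_forms_def ppp_def by blast
  ultimately have data: "superization_data \<rho> B c1 c2 c3 pmp ppp"
    using quad by (simp add: superization_data_def)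
  have "br (0, (s, t)) (0, (s, t)) = ((ppp t t + 2 * pmp s t) *\<^sub>R cw_p, 0)" for s t
    by (simp add: br\<Gamma> \<Gamma> odd odd_form_def)
  then have "superization_given_by \<rho> B c1 c2 c3 pmp ppp br"
    using flat vec q p0 by (auto simp: superization_given_by_def zero_prod_def)
  with data show ?thesis by (rule that)
qed

lemma superization_data_unique:
  assumes data: "superization_data \<rho> B c1 c2 c3 pmp ppp" "superization_data \<rho> B d1 d2 d3 rmp rpp"
    and br: "superization_given_by \<rho> B c1 c2 c3 pmp ppp br"
  shows "superization_given_by \<rho> B d1 d2 d3 rmp rpp br \<longleftrightarrow>
    \<rho> c1 = \<rho> d1 \<and> \<rho> c2 = \<rho> d2 \<and> \<rho> c3 = \<rho> d3 \<and> pmp = rmp \<and> ppp = rpp"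
proof
  assume br': "superization_given_by \<rho> B d1 d2 d3 rmp rpp br"
  have "block (\<rho> c1) (\<rho> c3) (\<lambda>s. 0) (\<rho> c2) = block (\<rho> d1) (\<rho> d3) (\<lambda>s. 0) (\<rho> d2)"
    using br br' unfolding superization_given_by_def by metis
  from fun_cong[OF this] have blocks: "\<rho> c1 s + \<rho> c3 t = \<rho> d1 s + \<rho> d3 t \<and> \<rho> c2 t = \<rho> d2 t" for s t
    by (metis block_apply add_0 prod.inject)
  have "\<rho> c1 s = \<rho> d1 s" "\<rho> c2 s = \<rho> d2 s" "\<rho> c3 s = \<rho> d3 s" for s
    using blocks[of s 0] blocks[of 0 s] by (simp_all add: repr)
  then have eq: "\<rho> c1 = \<rho> d1" "\<rho> c2 = \<rho> d2" "\<rho> c3 = \<rho> d3" by auto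
  note c = superization_dataD[OF data(1)] and d = superization_dataD[OF data(2)]
  have "odd_form pmp ppp (s, t) (s, t) = odd_form rmp rpp (s, t) (s, t)" for s t
  proof -
    have "br (0, (s, t)) (0, (s, t)) = ((ppp t t + 2 * pmp s t) *\<^sub>R cw_p, 0)"
      using br unfolding superization_given_by_def by blast
    moreover have "br (0, (s, t)) (0, (s, t)) = ((rpp t t + 2 * rmp s t) *\<^sub>R cw_p, 0)"
      using br' unfolding superization_given_by_def by blast
    ultimately show ?thesis by (simp add: odd_form_def cw_p_def)
  qed
  then have diag: "odd_form pmp ppp Q Q = odd_form rmp rpp Q Q" for Q by (cases Q) auto
  have "odd_form pmp ppp Q Q' = odd_form rmp rpp Q Q'" for Q Q'
    by (rule symmetric_bilinear_eqI[OF odd_form_bilinear[OF c(2,4)] odd_form_symmetric[OF c(5)]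
          odd_form_bilinear[OF d(2,4)] odd_form_symmetric[OF d(5)] diag])
  then have "odd_form pmp ppp = odd_form rmp rpp" by (intro ext)
  then show "\<rho> c1 = \<rho> d1 \<and> \<rho> c2 = \<rho> d2 \<and> \<rho> c3 = \<rho> d3 \<and> pmp = rmp \<and> ppp = rpp"
    using odd_form_inject[OF c(2,4) d(2,4)] eq by blast
next
  assume "\<rho> c1 = \<rho> d1 \<and> \<rho> c2 = \<rho> d2 \<and> \<rho> c3 = \<rho> d3 \<and> pmp = rmp \<and> ppp = rpp"
  then show "superization_given_by \<rho> B d1 d2 d3 rmp rpp br"
    using br by (simp add: superization_given_by_def)
qed

end

theorem theorem5p1:
  fixes n :: nat
    and b :: "'e::euclidean_space \<Rightarrow> 'e \<Rightarrow> real" and B :: "'e \<Rightarrow> 'e"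
    and \<rho> :: "'e clifford \<Rightarrow> 's::real_vector \<Rightarrow> 's"
  assumes "n \<ge> 2" and "DIM('e) = n - 1"
    and "nondegenerate_symmetric_form b" and "\<And>e f. b e f = - \<langle>B e,f\<rangle>"
    and "irreducible_representation \<rho>"
  shows
    "(\<forall>br. zero_charge_superization \<rho> b B br \<and> translational_supersymmetry br \<longrightarrow>
        (\<exists>c1 c2 c3 pmp ppp. superization_data \<rho> B c1 c2 c3 pmp ppp \<and>
          superization_given_by \<rho> B c1 c2 c3 pmp ppp br)) \<and>
     (\<forall>c1 c2 c3 pmp ppp. superization_data \<rho> B c1 c2 c3 pmp ppp \<longrightarrow>
        (\<exists>!br. zero_charge_superization \<rho> b B br \<and> translational_supersymmetry br \<and>
          superization_given_by \<rho> B c1 c2 c3 pmp ppp br)) \<and>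
     (\<forall>br c1 c2 c3 pmp ppp d1 d2 d3 rmp rpp.
        zero_charge_superization \<rho> b B br \<and> translational_supersymmetry br \<and>
        superization_data \<rho> B c1 c2 c3 pmp ppp \<and> superization_data \<rho> B d1 d2 d3 rmp rpp \<and>
        superization_given_by \<rho> B c1 c2 c3 pmp ppp br \<longrightarrow>
        (superization_given_by \<rho> B d1 d2 d3 rmp rpp br \<longleftrightarrow>
          c1 - d1 \<in> rep_kernel \<rho> \<and> c2 - d2 \<in> rep_kernel \<rho> \<and> c3 - d3 \<in> rep_kernel \<rho> \<and>
          pmp = rmp \<and> ppp = rpp))"
proof (intro conjI allI impI)
  note hyps = assms(5,3,4)
  fix br
  assume "zero_charge_superization \<rho> b B br \<and> translational_supersymmetry br"
  then show "\<exists>c1 c2 c3 pmp ppp. superization_data \<rho> B c1 c2 c3 pmp ppp \<and>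
      superization_given_by \<rho> B c1 c2 c3 pmp ppp br"
    using superization_classified[OF hyps] by metis
next
  note hyps = assms(5,3,4)
  fix c1 c2 c3 :: "'e clifford" and pmp ppp :: "'s \<Rightarrow> 's \<Rightarrow> real"
  assume "superization_data \<rho> B c1 c2 c3 pmp ppp"
  note correct = superization_correct[OF hyps this]
  show "\<exists>!br. zero_charge_superization \<rho> b B br \<and> translational_supersymmetry br \<and>
      superization_given_by \<rho> B c1 c2 c3 pmp ppp br"
    using correct superization_unique[OF hyps _ _ correct(1,3)] by (intro ex1I conjI) blast+
next
  fix br c1 c2 c3 pmp ppp d1 d2 d3 rmp rpp
  assume "zero_charge_superization \<rho> b B br \<and> translational_supersymmetry br \<and>
    superization_data \<rho> B c1 c2 c3 pmp ppp \<and> superization_data \<rho> B d1 d2 d3 rmp rpp \<and>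
    superization_given_by \<rho> B c1 c2 c3 pmp ppp br"
  then show "superization_given_by \<rho> B d1 d2 d3 rmp rpp br \<longleftrightarrow>
      c1 - d1 \<in> rep_kernel \<rho> \<and> c2 - d2 \<in> rep_kernel \<rho> \<and> c3 - d3 \<in> rep_kernel \<rho> \<and>
      pmp = rmp \<and> ppp = rpp"
    using superization_data_unique[OF assms(5,3,4)] by (simp add: rep_kernel_diff[OF assms(5)])
qed

end
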